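(* Let $A_1,A_2$ be disjoint finite involutively closed alphabets, let $\Theta_1=\{(\Gamma^{(i)},\gamma_0^i): i=1,\ldots,k\}$ be a finite collection of rooted $A_1$-graphs and $\Theta_2=\{(\Lambda^{(j)},\lambda_0^j): j=1,\ldots,m\}$ a finite collection of rooted $A_2$-graphs, with gluing map $\Psi$. If $(\Theta_1,\Theta_2,\Psi)$ is a context-free ensemble, then the free product $\Theta_1\star_\Psi\Theta_2$ is a context-free $A_1\cup A_2$-graph.
   Context: For a finite alphabet $A$ closed under a formal inversion $a\mapsto a^{-1}$ ($a^{-1}\neq a$), an $A$-graph is a connected directed graph $\Gamma$ with edges labeled by $A$ and a fixed-point-free involution $e\mapsto e^{-1}$ on edges exchanging initial and terminal vertices and inverting labels, which is deterministic (at most one outgoing $a$-edge at each vertex for each $a\in A$). A rooted $A$-graph $(\Gamma,x_0)$ has a distinguished vertex. End-cones. Let $d$ be the path metric and $\|v\|=d(x_0,v)$. For $v$ with $\|v\|=n$, the end-cone $\Gamma(v,x_0)$ is the connected component containing $v$ of the subgraph of $\Gamma$ obtained by removing all vertices at distance at most $n-1$ from $x_0$; its frontier vertices are its vertices at distance exactly $n$ from $x_0$. An end-isomorphism between two end-cones is an isomorphism of labeled graphs mapping frontier vertices onto frontier vertices. $(\Gamma,x_0)$ is context-free if it has finitely many end-cones up to end-isomorphism (equivalently, the language of labels of circuits at $x_0$ is context-free; this does not depend on the root). Colored version. A coloring of $(\Gamma,x_0)$ is a map $\chi:V(\Gamma)\setminus\{x_0\}\to C$ to a set $C$ of colors. End-cones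 are colored by restriction of $\chi$, and end-isomorphisms of colored end-cones are required to preserve colors. The colored rooted graph $(\Gamma,x_0;\chi)$ is context-free if it has finitely many end-cones up to color-preserving end-isomorphism. Gluing map. $\Psi$ is a collection of functions $\psi^1_i:V(\Gamma^{(i)})\setminus\{\gamma_0^i\}\to\{\lambda_0^1,\ldots,\lambda_0^m\}$ ($1\le i\le k$) and $\psi^2_j:V(\Lambda^{(j)})\setminus\{\lambda_0^j\}\to\{\gamma_0^1,\ldots,\gamma_0^k\}$ ($1\le j\le m$). Free product. $\Theta_1\star_\Psi\Theta_2$ is the rooted $A_1\cup A_2$-graph obtained from $\Gamma^{(1)}\sqcup\Lambda^{(1)}$ by identifying the roots $\gamma_0^1=\lambda_0^1$ (this is the root of the free product), and then iterating forever the following gluings: at each vertex which is a non-root vertex $\gamma$ of a copy of some $\Gamma^{(j)}$, glue a new copy of $(\Lambda^{(s)},\lambda_0^s)$, where $\lambda_0^s=\psi^1_j(\gamma)$, by identifying its root $\lambda_0^s$ with that vertex; at each vertex which is a non-root vertex $\lambda$ of a copy of some $\Lambda^{(j)}$, glue a new copy of $(\Gamma^{(s)},\gamma_0^s)$, where $\gamma_0^s=\psi^2_j(\lambda)$, by identifying its root with that vertex. $(\Theta_1,\Theta_2,\Psi)$ is a context-free ensemble if all the colored rooted graphs $(\Gamma^{(i)},\gamma_0^i;\psi^1_i)$, $1\le i\le k$, and $(\Lambda^{(j)},\lambda_0^j;\psi^2_j)$, $1\le j\le m$, are context-free. *)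

theory Defs
  imports Main
begin

text \<open>\<open>\<iota>\<close> is the formal inversion of the alphabet; only its values on \<open>A\<close> matter.\<close>

definition alphabet :: "('a \<Rightarrow> 'a) \<Rightarrow> 'a set \<Rightarrow> bool" where
  "alphabet \<iota> A \<longleftrightarrow> finite A \<and> (\<forall>a\<in>A. \<iota> a \<in> A \<and> \<iota> (\<iota> a) = a \<and> \<iota> a \<noteq> a)"

text \<open>An edge is the triple \<open>(u, a, w)\<close> of its initial vertex, label and terminal vertex. In a
  deterministic graph an edge is determined by its initial vertex and label, so nothing is lost,
  and the involution on edges is forced to be \<open>(u, a, w) \<mapsto> (w, \<iota> a, u)\<close>. It has no fixed points
  because \<open>\<iota> a \<noteq> a\<close>.\<close>

record ('v, 'a) lgraph =
  verts :: "'v set"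
  edges :: "('v \<times> 'a \<times> 'v) set"

definition adj :: "('v, 'a) lgraph \<Rightarrow> ('v \<times> 'v) set" where
  "adj \<Gamma> = {(u, w). \<exists>a. (u, a, w) \<in> edges \<Gamma>}"

definition A_graph :: "('a \<Rightarrow> 'a) \<Rightarrow> 'a set \<Rightarrow> ('v, 'a) lgraph \<Rightarrow> bool" where
  "A_graph \<iota> A \<Gamma> \<longleftrightarrow>
     alphabet \<iota> A \<and>
     edges \<Gamma> \<subseteq> verts \<Gamma> \<times> A \<times> verts \<Gamma> \<and>
     (\<forall>u a w. (u, a, w) \<in> edges \<Gamma> \<longrightarrow> (w, \<iota> a, u) \<in> edges \<Gamma>) \<and>
     (\<forall>u a w w'. (u, a, w) \<in> edges \<Gamma> \<longrightarrow> (u, a, w') \<in> edges \<Gamma> \<longrightarrow> w = w') \<and>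
     (\<forall>u\<in>verts \<Gamma>. \<forall>w\<in>verts \<Gamma>. (u, w) \<in> (adj \<Gamma>)\<^sup>*)"

definition rooted_A_graph :: "('a \<Rightarrow> 'a) \<Rightarrow> 'a set \<Rightarrow> ('v, 'a) lgraph \<Rightarrow> 'v \<Rightarrow> bool" where
  "rooted_A_graph \<iota> A \<Gamma> x\<^sub>0 \<longleftrightarrow> A_graph \<iota> A \<Gamma> \<and> x\<^sub>0 \<in> verts \<Gamma>"

text \<open>The path metric. It is only meaningful for \<open>u\<close> and \<open>w\<close> joined by a path. In an
  \<open>A\<close>-graph every edge has an inverse, so directed and undirected paths give the same metric.\<close>

definition path_dist :: "('v, 'a) lgraph \<Rightarrow> 'v \<Rightarrow> 'v \<Rightarrow> nat" where
  "path_dist \<Gamma> u w = (LEAST n. (u, w) \<in> adj \<Gamma> ^^ n)"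

definition induced_subgraph :: "('v, 'a) lgraph \<Rightarrow> 'v set \<Rightarrow> ('v, 'a) lgraph" where
  "induced_subgraph \<Gamma> S =
     \<lparr>verts = verts \<Gamma> \<inter> S, edges = {(u, a, w) \<in> edges \<Gamma>. u \<in> S \<and> w \<in> S}\<rparr>"

definition component :: "('v, 'a) lgraph \<Rightarrow> 'v \<Rightarrow> ('v, 'a) lgraph" where
  "component \<Gamma> v = induced_subgraph \<Gamma> {w. (v, w) \<in> (adj \<Gamma>)\<^sup>*}"

text \<open>Removing the vertices at distance at most \<open>n - 1\<close> from the root (none if \<open>n = 0\<close>) means
  keeping those at distance at least \<open>n\<close>.\<close>

definition end_cone :: "('v, 'a) lgraph \<Rightarrow> 'v \<Rightarrow> 'v \<Rightarrow> ('v, 'a) lgraph" where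
  "end_cone \<Gamma> x\<^sub>0 v =
     component (induced_subgraph \<Gamma> {u. path_dist \<Gamma> x\<^sub>0 v \<le> path_dist \<Gamma> x\<^sub>0 u}) v"

definition frontier :: "('v, 'a) lgraph \<Rightarrow> 'v \<Rightarrow> 'v \<Rightarrow> 'v set" where
  "frontier \<Gamma> x\<^sub>0 v =
     {u \<in> verts (end_cone \<Gamma> x\<^sub>0 v). path_dist \<Gamma> x\<^sub>0 u = path_dist \<Gamma> x\<^sub>0 v}"

definition lgraph_iso :: "('v \<Rightarrow> 'w) \<Rightarrow> ('v, 'a) lgraph \<Rightarrow> ('w, 'a) lgraph \<Rightarrow> bool" where
  "lgraph_iso f \<Gamma> \<Delta> \<longleftrightarrow>
     bij_betw f (verts \<Gamma>) (verts \<Delta>) \<and> edges \<Delta> = (\<lambda>(u, a, w). (f u, a, f w)) ` edges \<Gamma>"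

definition end_isomorphism :: "('v, 'a) lgraph \<Rightarrow> 'v \<Rightarrow> ('v \<Rightarrow> 'v) \<Rightarrow> 'v \<Rightarrow> 'v \<Rightarrow> bool" where
  "end_isomorphism \<Gamma> x\<^sub>0 f u v \<longleftrightarrow>
     lgraph_iso f (end_cone \<Gamma> x\<^sub>0 u) (end_cone \<Gamma> x\<^sub>0 v) \<and>
     f ` frontier \<Gamma> x\<^sub>0 u = frontier \<Gamma> x\<^sub>0 v"

text \<open>End-cones are indexed by the vertices defining them. Distinct vertices with the same
  end-cone are identified in the quotient.\<close>

definition context_free :: "('v, 'a) lgraph \<Rightarrow> 'v \<Rightarrow> bool" where
  "context_free \<Gamma> x\<^sub>0 \<longleftrightarrow>
     finite (verts \<Gamma> //
       {(u, v). u \<in> verts \<Gamma> \<and> v \<in> verts \<Gamma> \<and> (\<exists>f. end_isomorphism \<Gamma> x\<^sub>0 f u v)})"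

text \<open>Colorings are partial functions, the root being uncolored.\<close>

definition coloring :: "('v, 'a) lgraph \<Rightarrow> 'v \<Rightarrow> 'c set \<Rightarrow> ('v \<rightharpoonup> 'c) \<Rightarrow> bool" where
  "coloring \<Gamma> x\<^sub>0 C \<chi> \<longleftrightarrow> dom \<chi> = verts \<Gamma> - {x\<^sub>0} \<and> ran \<chi> \<subseteq> C"

definition colored_end_isomorphism ::
    "('v, 'a) lgraph \<Rightarrow> 'v \<Rightarrow> ('v \<rightharpoonup> 'c) \<Rightarrow> ('v \<Rightarrow> 'v) \<Rightarrow> 'v \<Rightarrow> 'v \<Rightarrow> bool" where
  "colored_end_isomorphism \<Gamma> x\<^sub>0 \<chi> f u v \<longleftrightarrow>
     end_isomorphism \<Gamma> x\<^sub>0 f u v \<and> (\<forall>w\<in>verts (end_cone \<Gamma> x\<^sub>0 u). \<chi> (f w) = \<chi> w)"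

definition colored_context_free :: "('v, 'a) lgraph \<Rightarrow> 'v \<Rightarrow> ('v \<rightharpoonup> 'c) \<Rightarrow> bool" where
  "colored_context_free \<Gamma> x\<^sub>0 \<chi> \<longleftrightarrow>
     finite (verts \<Gamma> //
       {(u, v). u \<in> verts \<Gamma> \<and> v \<in> verts \<Gamma> \<and> (\<exists>f. colored_end_isomorphism \<Gamma> x\<^sub>0 \<chi> f u v)})"

text \<open>The values of a gluing function are roots \<open>\<gamma>\<^sub>0 s\<close> or \<open>l\<^sub>0 s\<close>. Each is represented by its index
  \<open>s\<close>, since the roots of different graphs need not be distinct as elements of the type.\<close>

definition gluing_map ::
    "nat \<Rightarrow> (nat \<Rightarrow> ('v, 'a) lgraph) \<Rightarrow> (nat \<Rightarrow> 'v) \<Rightarrow>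
     nat \<Rightarrow> (nat \<Rightarrow> ('w, 'a) lgraph) \<Rightarrow> (nat \<Rightarrow> 'w) \<Rightarrow>
     (nat \<Rightarrow> 'v \<rightharpoonup> nat) \<Rightarrow> (nat \<Rightarrow> 'w \<rightharpoonup> nat) \<Rightarrow> bool" where
  "gluing_map k \<Gamma> \<gamma>\<^sub>0 m \<Lambda> l\<^sub>0 \<psi>\<^sub>1 \<psi>\<^sub>2 \<longleftrightarrow>
     (\<forall>i\<in>{1..k}. coloring (\<Gamma> i) (\<gamma>\<^sub>0 i) {1..m} (\<psi>\<^sub>1 i)) \<and>
     (\<forall>j\<in>{1..m}. coloring (\<Lambda> j) (l\<^sub>0 j) {1..k} (\<psi>\<^sub>2 j))"

definition context_free_ensemble ::
    "nat \<Rightarrow> (nat \<Rightarrow> ('v, 'a) lgraph) \<Rightarrow> (nat \<Rightarrow> 'v) \<Rightarrow>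
     nat \<Rightarrow> (nat \<Rightarrow> ('w, 'a) lgraph) \<Rightarrow> (nat \<Rightarrow> 'w) \<Rightarrow>
     (nat \<Rightarrow> 'v \<rightharpoonup> nat) \<Rightarrow> (nat \<Rightarrow> 'w \<rightharpoonup> nat) \<Rightarrow> bool" where
  "context_free_ensemble k \<Gamma> \<gamma>\<^sub>0 m \<Lambda> l\<^sub>0 \<psi>\<^sub>1 \<psi>\<^sub>2 \<longleftrightarrow>
     (\<forall>i\<in>{1..k}. colored_context_free (\<Gamma> i) (\<gamma>\<^sub>0 i) (\<psi>\<^sub>1 i)) \<and>
     (\<forall>j\<in>{1..m}. colored_context_free (\<Lambda> j) (l\<^sub>0 j) (\<psi>\<^sub>2 j))"

text \<open>A vertex of the free product is the word, most recent letter first, of the non-root vertices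
  through which it is reached in the successive glued copies; the root is the empty word.
  \<open>copy\<^sub>1 s p\<close> says that a copy of \<open>\<Gamma> s\<close> is glued with its root at the vertex \<open>p\<close>, and \<open>copy\<^sub>2 s p\<close>
  says the same of \<open>\<Lambda> s\<close>. The index \<open>s\<close> is determined by \<open>p\<close> and the side, so that a copy is
  identified by these two.\<close>

inductive copy\<^sub>1 and copy\<^sub>2
  for \<Gamma> :: "nat \<Rightarrow> ('v, 'a) lgraph" and \<gamma>\<^sub>0 :: "nat \<Rightarrow> 'v"
    and \<Lambda> :: "nat \<Rightarrow> ('w, 'a) lgraph" and l\<^sub>0 :: "nat \<Rightarrow> 'w"
    and \<psi>\<^sub>1 :: "nat \<Rightarrow> 'v \<rightharpoonup> nat" and \<psi>\<^sub>2 :: "nat \<Rightarrow> 'w \<rightharpoonup> nat"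
  where
    init\<^sub>1: "copy\<^sub>1 \<Gamma> \<gamma>\<^sub>0 \<Lambda> l\<^sub>0 \<psi>\<^sub>1 \<psi>\<^sub>2 1 []"
  | init\<^sub>2: "copy\<^sub>2 \<Gamma> \<gamma>\<^sub>0 \<Lambda> l\<^sub>0 \<psi>\<^sub>1 \<psi>\<^sub>2 1 []"
  | glue\<^sub>2: "\<lbrakk>copy\<^sub>1 \<Gamma> \<gamma>\<^sub>0 \<Lambda> l\<^sub>0 \<psi>\<^sub>1 \<psi>\<^sub>2 j p; \<gamma> \<in> verts (\<Gamma> j) - {\<gamma>\<^sub>0 j}; \<psi>\<^sub>1 j \<gamma> = Some s\<rbrakk>
      \<Longrightarrow> copy\<^sub>2 \<Gamma> \<gamma>\<^sub>0 \<Lambda> l\<^sub>0 \<psi>\<^sub>1 \<psi>\<^sub>2 s (Inl \<gamma> # p)"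
  | glue\<^sub>1: "\<lbrakk>copy\<^sub>2 \<Gamma> \<gamma>\<^sub>0 \<Lambda> l\<^sub>0 \<psi>\<^sub>1 \<psi>\<^sub>2 j p; l \<in> verts (\<Lambda> j) - {l\<^sub>0 j}; \<psi>\<^sub>2 j l = Some s\<rbrakk>
      \<Longrightarrow> copy\<^sub>1 \<Gamma> \<gamma>\<^sub>0 \<Lambda> l\<^sub>0 \<psi>\<^sub>1 \<psi>\<^sub>2 s (Inr l # p)"

text \<open>The position in the free product of a vertex of a copy glued at \<open>p\<close>; here \<open>tag\<close> is \<open>Inl\<close> for
  copies of the \<open>\<Gamma> s\<close> and \<open>Inr\<close> for copies of the \<open>\<Lambda> s\<close>. The root of the copy is identified
  with \<open>p\<close>.\<close>

definition place :: "('x \<Rightarrow> 'v + 'w) \<Rightarrow> 'x \<Rightarrow> ('v + 'w) list \<Rightarrow> 'x \<Rightarrow> ('v + 'w) list" where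
  "place tag x\<^sub>0 p x = (if x = x\<^sub>0 then p else tag x # p)"

definition free_product ::
    "(nat \<Rightarrow> ('v, 'a) lgraph) \<Rightarrow> (nat \<Rightarrow> 'v) \<Rightarrow>
     (nat \<Rightarrow> ('w, 'a) lgraph) \<Rightarrow> (nat \<Rightarrow> 'w) \<Rightarrow>
     (nat \<Rightarrow> 'v \<rightharpoonup> nat) \<Rightarrow> (nat \<Rightarrow> 'w \<rightharpoonup> nat) \<Rightarrow> (('v + 'w) list, 'a) lgraph" where
  "free_product \<Gamma> \<gamma>\<^sub>0 \<Lambda> l\<^sub>0 \<psi>\<^sub>1 \<psi>\<^sub>2 =
     \<lparr>verts =
        {place Inl (\<gamma>\<^sub>0 s) p x | s p x. copy\<^sub>1 \<Gamma> \<gamma>\<^sub>0 \<Lambda> l\<^sub>0 \<psi>\<^sub>1 \<psi>\<^sub>2 s p \<and> x \<in> verts (\<Gamma> s)} \<union>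
        {place Inr (l\<^sub>0 s) p x | s p x. copy\<^sub>2 \<Gamma> \<gamma>\<^sub>0 \<Lambda> l\<^sub>0 \<psi>\<^sub>1 \<psi>\<^sub>2 s p \<and> x \<in> verts (\<Lambda> s)},
      edges =
        {(place Inl (\<gamma>\<^sub>0 s) p x, a, place Inl (\<gamma>\<^sub>0 s) p y) | s p x a y.
           copy\<^sub>1 \<Gamma> \<gamma>\<^sub>0 \<Lambda> l\<^sub>0 \<psi>\<^sub>1 \<psi>\<^sub>2 s p \<and> (x, a, y) \<in> edges (\<Gamma> s)} \<union>
        {(place Inr (l\<^sub>0 s) p x, a, place Inr (l\<^sub>0 s) p y) | s p x a y.
           copy\<^sub>2 \<Gamma> \<gamma>\<^sub>0 \<Lambda> l\<^sub>0 \<psi>\<^sub>1 \<psi>\<^sub>2 s p \<and> (x, a, y) \<in> edges (\<Lambda> s)}\<rparr>"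

definition free_product_root :: "('v + 'w) list" where
  "free_product_root = []"

end

theory Submission
  imports Defs
begin

text \<open>Think of the free product as a tree of copies, each meeting its parent copy in a single
  vertex. Let \<open>v\<close> be a vertex other than the root. It is a non-root vertex \<open>x\<close> of a unique copy,
  glued at some \<open>p\<close>, of one of the given graphs. A path from the root to \<open>v\<close> must pass through the
  cut vertex \<open>p\<close>, so the norm of \<open>v\<close> is the norm of \<open>p\<close> plus the distance of \<open>x\<close> from the root of
  its graph (\<open>path_dist_product\<close>). The end-cone of \<open>v\<close> is therefore confined to what lies beyond
  \<open>p\<close>: it is the end-cone of \<open>x\<close> in its own graph, together with everything that hangs from the
  vertices of that cone, and nothing of this hanging part is cut off, because norms only grow in it
  (\<open>verts_end_cone_product\<close>).

  What hangs from a vertex depends only on its color, which names the next graph to be glued. So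
  a color-preserving end-isomorphism between the end-cones of \<open>x\<close> and \<open>x'\<close> in one of the given
  graphs extends, by translating the hanging parts rigidly, to an end-isomorphism between the
  end-cones at any two occurrences of \<open>x\<close> and \<open>x'\<close> in the free product
  (\<open>end_isomorphism_move\<close>). The type of a non-root end-cone is thus determined by the index of a
  graph and the type of one of its colored end-cones. There are finitely many such pairs, and the
  root adds one more type (\<open>context_free_product\<close>).

  The product is connected because each copy is connected to its root, and deterministic because
  two copies that share a vertex have disjoint alphabets (\<open>rooted_A_graph_product\<close>).

  The two families of graphs play symmetric roles. To treat them at once, their vertices are made
  disjoint by renaming, which changes no end-cone up to isomorphism, and they are regarded as a
  single family of pieces with two sides, subject to the rule that a copy is only glued to a vertex
  of a copy of the other side (locale \<open>alternating_gluing\<close>).\<close>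

section \<open>Distances from the root\<close>

lemma adjE: "(u, w) \<in> adj \<Gamma> \<Longrightarrow> (\<And>a. (u, a, w) \<in> edges \<Gamma> \<Longrightarrow> P) \<Longrightarrow> P"
  by (auto simp: adj_def)

lemma path_dist_root [simp]: "path_dist \<Gamma> x x = 0"
  unfolding path_dist_def by (rule Least_eq_0) simp

lemma path_dist_attained:
  assumes "(x, v) \<in> (adj \<Gamma>)\<^sup>*"
  shows "(x, v) \<in> adj \<Gamma> ^^ path_dist \<Gamma> x v"
proof -
  from assms obtain n where "(x, v) \<in> adj \<Gamma> ^^ n"
    by (auto simp: rtrancl_is_UN_relpow)
  then show ?thesis unfolding path_dist_def by (rule LeastI)
qed

lemma path_dist_le: "(x, v) \<in> adj \<Gamma> ^^ n \<Longrightarrow> path_dist \<Gamma> x v \<le> n"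
  unfolding path_dist_def by (rule Least_le)

lemma path_dist_step:
  assumes "(x, u) \<in> (adj \<Gamma>)\<^sup>*" and "(u, w) \<in> adj \<Gamma>"
  shows "path_dist \<Gamma> x w \<le> Suc (path_dist \<Gamma> x u)"
  using path_dist_attained[OF assms(1)] assms(2) by (intro path_dist_le) auto

lemma path_dist_eq_0: "(x, v) \<in> (adj \<Gamma>)\<^sup>* \<Longrightarrow> path_dist \<Gamma> x v = 0 \<Longrightarrow> v = x"
  using path_dist_attained[of x v \<Gamma>] by auto

lemma path_dist_predecessor:
  assumes "(x, v) \<in> (adj \<Gamma>)\<^sup>*" and "path_dist \<Gamma> x v = Suc n"
  obtains u where "(u, v) \<in> adj \<Gamma>" and "path_dist \<Gamma> x u = n"
proof -
  from path_dist_attained[OF assms(1)] assms(2) obtain u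
    where xu: "(x, u) \<in> adj \<Gamma> ^^ n" and uv: "(u, v) \<in> adj \<Gamma>" by auto
  have "path_dist \<Gamma> x v \<le> Suc (path_dist \<Gamma> x u)"
    using xu uv by (intro path_dist_step) (auto simp: relpow_imp_rtrancl)
  with path_dist_le[OF xu] assms(2) have "path_dist \<Gamma> x u = n" by simp
  with uv that show thesis by blast
qed

text \<open>Conversely, a function that grows by at most one along edges, and from each of whose
  positive values an edge leads back to a value one smaller, is the distance from its only zero.
  This gives the distances in a free product, and its connectedness, without any analysis of its
  paths.\<close>

lemma path_dist_eqI:
  assumes zero: "h x = 0" "\<And>v. v \<in> verts \<Gamma> \<Longrightarrow> h v = 0 \<Longrightarrow> v = x"
    and step: "\<And>u w. (u, w) \<in> adj \<Gamma> \<Longrightarrow> h w \<le> Suc (h u)"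
    and descend: "\<And>v n. v \<in> verts \<Gamma> \<Longrightarrow> h v = Suc n
      \<Longrightarrow> \<exists>u\<in>verts \<Gamma>. (u, v) \<in> adj \<Gamma> \<and> h u = n"
    and v: "v \<in> verts \<Gamma>"
  shows "(x, v) \<in> (adj \<Gamma>)\<^sup>*" and "path_dist \<Gamma> x v = (h v :: nat)"
proof -
  have path: "(x, v) \<in> adj \<Gamma> ^^ n" if "v \<in> verts \<Gamma>" "h v = n" for v n
    using that
  proof (induction n arbitrary: v)
    case 0
    then show ?case using zero by auto
  next
    case (Suc n)
    then show ?case using descend[of v n] by auto
  qed
  have bound: "h w \<le> n" if "(x, w) \<in> adj \<Gamma> ^^ n" for w n
    using that
  proof (induction n arbitrary: w)
    case 0
    then show ?case using zero by simp
  next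
    case (Suc n)
    then obtain u where "(x, u) \<in> adj \<Gamma> ^^ n" "(u, w) \<in> adj \<Gamma>" by auto
    with Suc.IH[of u] step[of u w] show ?case by simp
  qed
  show reach: "(x, v) \<in> (adj \<Gamma>)\<^sup>*"
    using path[OF v refl] by (rule relpow_imp_rtrancl)
  show "path_dist \<Gamma> x v = h v"
    using path_dist_le[OF path[OF v refl]] bound[OF path_dist_attained[OF reach]] by simp
qed

section \<open>End-cones and the equivalence of their vertices\<close>

text \<open>The condition under which an isomorphism, whose action on edges is given by its action on
  vertices, can be inverted. End-cones inherit it from the ambient graph.\<close>

definition closed_edges :: "('v, 'a) lgraph \<Rightarrow> bool" where
  "closed_edges \<Gamma> \<longleftrightarrow> edges \<Gamma> \<subseteq> verts \<Gamma> \<times> UNIV \<times> verts \<Gamma>"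

lemma rooted_A_graph_closed_edges: "rooted_A_graph \<iota> A \<Gamma> x \<Longrightarrow> closed_edges \<Gamma>"
  by (auto simp: rooted_A_graph_def A_graph_def closed_edges_def)

lemma rooted_A_graph_reachable:
  "rooted_A_graph \<iota> A \<Gamma> x \<Longrightarrow> v \<in> verts \<Gamma> \<Longrightarrow> (x, v) \<in> (adj \<Gamma>)\<^sup>*"
  by (auto simp: rooted_A_graph_def A_graph_def)

definition upper_part :: "('v, 'a) lgraph \<Rightarrow> 'v \<Rightarrow> 'v \<Rightarrow> ('v, 'a) lgraph" where
  "upper_part \<Gamma> x v = induced_subgraph \<Gamma> {u. path_dist \<Gamma> x v \<le> path_dist \<Gamma> x u}"

lemma end_cone_upper_part: "end_cone \<Gamma> x v = component (upper_part \<Gamma> x v) v"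
  by (simp add: end_cone_def upper_part_def)

lemma adj_upper_part:
  "(u, w) \<in> adj (upper_part \<Gamma> x v) \<longleftrightarrow> (u, w) \<in> adj \<Gamma>
    \<and> path_dist \<Gamma> x v \<le> path_dist \<Gamma> x u \<and> path_dist \<Gamma> x v \<le> path_dist \<Gamma> x w"
  by (auto simp: adj_def upper_part_def induced_subgraph_def)

lemma upper_part_reachable:
  assumes "closed_edges \<Gamma>" "v \<in> verts \<Gamma>" "(v, w) \<in> (adj (upper_part \<Gamma> x v))\<^sup>*"
  shows "w \<in> verts \<Gamma> \<and> path_dist \<Gamma> x v \<le> path_dist \<Gamma> x w"
  using assms(3)
proof (induction rule: rtrancl_induct)
  case base
  then show ?case using assms(2) by simp
next
  case (step u w)
  then show ?case using assms(1) by (auto simp: adj_upper_part closed_edges_def elim: adjE)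
qed

lemma verts_end_cone:
  assumes "closed_edges \<Gamma>" "v \<in> verts \<Gamma>"
  shows "verts (end_cone \<Gamma> x v) = {w. (v, w) \<in> (adj (upper_part \<Gamma> x v))\<^sup>*}"
proof -
  have "verts (upper_part \<Gamma> x v) = {u \<in> verts \<Gamma>. path_dist \<Gamma> x v \<le> path_dist \<Gamma> x u}"
    by (simp add: upper_part_def induced_subgraph_def Int_def)
  then have "{w. (v, w) \<in> (adj (upper_part \<Gamma> x v))\<^sup>*} \<subseteq> verts (upper_part \<Gamma> x v)"
    using upper_part_reachable[OF assms, of _ x] by blast
  moreover have "verts (end_cone \<Gamma> x v) =
    verts (upper_part \<Gamma> x v) \<inter> {w. (v, w) \<in> (adj (upper_part \<Gamma> x v))\<^sup>*}"
    by (simp add: end_cone_upper_part component_def induced_subgraph_def[of "upper_part \<Gamma> x v"])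
  ultimately show ?thesis by blast
qed

lemma edges_end_cone:
  assumes "closed_edges \<Gamma>" "v \<in> verts \<Gamma>"
  shows "edges (end_cone \<Gamma> x v) =
    {(u, a, w) \<in> edges \<Gamma>. u \<in> verts (end_cone \<Gamma> x v) \<and> w \<in> verts (end_cone \<Gamma> x v)}"
proof -
  define W where "W = {w. (v, w) \<in> (adj (upper_part \<Gamma> x v))\<^sup>*}"
  have level: "path_dist \<Gamma> x v \<le> path_dist \<Gamma> x w" if "w \<in> W" for w
    using upper_part_reachable[OF assms, of w x] that by (simp add: W_def)
  have "edges (end_cone \<Gamma> x v) = {(u, a, w) \<in> edges (upper_part \<Gamma> x v). u \<in> W \<and> w \<in> W}"
    by (simp add: end_cone_upper_part component_def induced_subgraph_def[of "upper_part \<Gamma> x v"] W_def)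
  also have "\<dots> = {(u, a, w) \<in> edges \<Gamma>. u \<in> W \<and> w \<in> W}"
    using level by (auto simp: upper_part_def induced_subgraph_def)
  finally show ?thesis unfolding verts_end_cone[OF assms] W_def[symmetric] .
qed

lemma end_cone_level:
  assumes "closed_edges \<Gamma>" "v \<in> verts \<Gamma>" "w \<in> verts (end_cone \<Gamma> x v)"
  shows "w \<in> verts \<Gamma>" and "path_dist \<Gamma> x v \<le> path_dist \<Gamma> x w"
  using upper_part_reachable[OF assms(1,2)] assms(3) by (auto simp: verts_end_cone[OF assms(1,2)])

lemma closed_edges_end_cone:
  "closed_edges \<Gamma> \<Longrightarrow> v \<in> verts \<Gamma> \<Longrightarrow> closed_edges (end_cone \<Gamma> x v)"
  by (auto simp: closed_edges_def[of "end_cone \<Gamma> x v"] edges_end_cone)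

lemma lgraph_isoI:
  assumes "closed_edges \<Delta>"
    and f: "\<And>u. u \<in> verts \<Gamma> \<Longrightarrow> f u \<in> verts \<Delta> \<and> g (f u) = u"
    and g: "\<And>w. w \<in> verts \<Delta> \<Longrightarrow> g w \<in> verts \<Gamma> \<and> f (g w) = w"
    and fe: "\<And>u a w. (u, a, w) \<in> edges \<Gamma> \<Longrightarrow> (f u, a, f w) \<in> edges \<Delta>"
    and ge: "\<And>u a w. (u, a, w) \<in> edges \<Delta> \<Longrightarrow> (g u, a, g w) \<in> edges \<Gamma>"
  shows "lgraph_iso f \<Gamma> \<Delta>"
  unfolding lgraph_iso_def
proof
  show "bij_betw f (verts \<Gamma>) (verts \<Delta>)"
    by (rule bij_betw_byWitness[where f' = g]) (use f g in auto)
  have "(u, a, w) \<in> (\<lambda>(u, a, w). (f u, a, f w)) ` edges \<Gamma>" if e: "(u, a, w) \<in> edges \<Delta>" for u a w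
  proof -
    have "u \<in> verts \<Delta>" "w \<in> verts \<Delta>" using e assms(1) by (auto simp: closed_edges_def)
    then have "(u, a, w) = (\<lambda>(u, a, w). (f u, a, f w)) (g u, a, g w)" using g by simp
    with ge[OF e] show ?thesis by (rule rev_image_eqI)
  qed
  then show "edges \<Delta> = (\<lambda>(u, a, w). (f u, a, f w)) ` edges \<Gamma>"
    using fe by auto
qed

lemma lgraph_iso_edge: "lgraph_iso f \<Gamma> \<Delta> \<Longrightarrow> (u, a, w) \<in> edges \<Gamma> \<Longrightarrow> (f u, a, f w) \<in> edges \<Delta>"
  unfolding lgraph_iso_def by (auto intro: rev_image_eqI)

lemma lgraph_iso_inverse:
  assumes iso: "lgraph_iso f \<Gamma> \<Delta>" and "closed_edges \<Gamma>"
  shows "lgraph_iso (inv_into (verts \<Gamma>) f) \<Delta> \<Gamma>"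
proof (rule lgraph_isoI[where g = f])
  have bij: "bij_betw f (verts \<Gamma>) (verts \<Delta>)" using iso by (simp add: lgraph_iso_def)
  show "inv_into (verts \<Gamma>) f u \<in> verts \<Gamma> \<and> f (inv_into (verts \<Gamma>) f u) = u" if "u \<in> verts \<Delta>" for u
    using that bij_betw_inv_into_right[OF bij that] bij_betwE[OF bij_betw_inv_into[OF bij]] by blast
  show "f w \<in> verts \<Delta> \<and> inv_into (verts \<Gamma>) f (f w) = w" if "w \<in> verts \<Gamma>" for w
    using that bij_betwE[OF bij] bij_betw_inv_into_left[OF bij that] by blast
  show "(f u, a, f w) \<in> edges \<Delta>" if "(u, a, w) \<in> edges \<Gamma>" for u a w
    using iso that by (rule lgraph_iso_edge)
  fix u a w assume "(u, a, w) \<in> edges \<Delta>"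
  then obtain u' w' where e: "(u', a, w') \<in> edges \<Gamma>" and uw: "u = f u'" "w = f w'"
    using iso by (auto simp: lgraph_iso_def)
  then have "u' \<in> verts \<Gamma>" "w' \<in> verts \<Gamma>" using assms(2) by (auto simp: closed_edges_def)
  with e uw bij show "(inv_into (verts \<Gamma>) f u, a, inv_into (verts \<Gamma>) f w) \<in> edges \<Gamma>"
    by (simp add: bij_betw_def)
qed fact

lemma lgraph_iso_compose:
  "lgraph_iso f \<Gamma> \<Delta> \<Longrightarrow> lgraph_iso g \<Delta> \<Xi> \<Longrightarrow> lgraph_iso (g \<circ> f) \<Gamma> \<Xi>"
  by (auto simp: lgraph_iso_def bij_betw_trans image_image case_prod_beta)

definition colored_cone_equiv :: "('v, 'a) lgraph \<Rightarrow> 'v \<Rightarrow> ('v \<rightharpoonup> 'c) \<Rightarrow> ('v \<times> 'v) set" where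
  "colored_cone_equiv \<Gamma> x \<chi> =
    {(u, v). u \<in> verts \<Gamma> \<and> v \<in> verts \<Gamma> \<and> (\<exists>f. colored_end_isomorphism \<Gamma> x \<chi> f u v)}"

lemma colored_context_free_iff:
  "colored_context_free \<Gamma> x \<chi> \<longleftrightarrow> finite (verts \<Gamma> // colored_cone_equiv \<Gamma> x \<chi>)"
  by (simp add: colored_context_free_def colored_cone_equiv_def)

text \<open>An uncolored graph is a graph on which no vertex has a color, so that what is shown for
  colored end-cones need not be repeated for uncolored ones.\<close>

lemma context_free_eq_colored:
  "context_free \<Gamma> x \<longleftrightarrow> colored_context_free \<Gamma> x (Map.empty :: _ \<rightharpoonup> unit)"
  by (simp add: context_free_def colored_context_free_def colored_end_isomorphism_def)

lemma colored_end_isomorphism_iff: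
  "colored_end_isomorphism \<Gamma> x \<chi> f u v \<longleftrightarrow>
    lgraph_iso f (end_cone \<Gamma> x u) (end_cone \<Gamma> x v) \<and> f ` frontier \<Gamma> x u = frontier \<Gamma> x v \<and>
    (\<forall>w\<in>verts (end_cone \<Gamma> x u). \<chi> (f w) = \<chi> w)"
  by (simp add: colored_end_isomorphism_def end_isomorphism_def)

lemma colored_end_isomorphism_maps:
  assumes "colored_end_isomorphism \<Gamma> x \<chi> f u v" "w \<in> verts (end_cone \<Gamma> x u)"
  shows "f w \<in> verts (end_cone \<Gamma> x v)" and "\<chi> (f w) = \<chi> w"
proof -
  have "bij_betw f (verts (end_cone \<Gamma> x u)) (verts (end_cone \<Gamma> x v))"
    using assms(1) by (simp add: colored_end_isomorphism_iff lgraph_iso_def)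
  from bij_betw_apply[OF this assms(2)] show "f w \<in> verts (end_cone \<Gamma> x v)" .
  show "\<chi> (f w) = \<chi> w" using assms by (simp add: colored_end_isomorphism_iff)
qed

lemma colored_end_isomorphism_inverse:
  assumes "closed_edges \<Gamma>" "u \<in> verts \<Gamma>" and iso: "colored_end_isomorphism \<Gamma> x \<chi> f u v"
  shows "colored_end_isomorphism \<Gamma> x \<chi> (inv_into (verts (end_cone \<Gamma> x u)) f) v u"
proof -
  let ?U = "verts (end_cone \<Gamma> x u)"
  let ?g = "inv_into ?U f"
  have li: "lgraph_iso f (end_cone \<Gamma> x u) (end_cone \<Gamma> x v)"
    and fr: "f ` frontier \<Gamma> x u = frontier \<Gamma> x v"
    using iso by (simp_all add: colored_end_isomorphism_iff)
  then have bij: "bij_betw f ?U (verts (end_cone \<Gamma> x v))"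
    by (simp add: lgraph_iso_def)
  have "lgraph_iso ?g (end_cone \<Gamma> x v) (end_cone \<Gamma> x u)"
    using li closed_edges_end_cone[OF assms(1,2)] by (rule lgraph_iso_inverse)
  moreover have "frontier \<Gamma> x u \<subseteq> ?U"
    unfolding frontier_def by (rule Collect_restrict)
  then have "?g ` frontier \<Gamma> x v = frontier \<Gamma> x u"
    unfolding fr[symmetric] by (rule inv_into_image_cancel[OF bij_betw_imp_inj_on[OF bij]])
  moreover have "\<chi> (?g w) = \<chi> w" if w: "w \<in> verts (end_cone \<Gamma> x v)" for w
    using colored_end_isomorphism_maps(2)[OF iso bij_betw_apply[OF bij_betw_inv_into[OF bij] w]]
    by (simp add: bij_betw_inv_into_right[OF bij w])
  ultimately show ?thesis
    by (simp add: colored_end_isomorphism_iff)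
qed

lemma colored_end_isomorphism_compose:
  assumes "colored_end_isomorphism \<Gamma> x \<chi> f u v" "colored_end_isomorphism \<Gamma> x \<chi> g v w"
  shows "colored_end_isomorphism \<Gamma> x \<chi> (g \<circ> f) u w"
  unfolding colored_end_isomorphism_iff
proof (intro conjI ballI)
  show "lgraph_iso (g \<circ> f) (end_cone \<Gamma> x u) (end_cone \<Gamma> x w)"
    using assms by (simp add: colored_end_isomorphism_iff lgraph_iso_compose[where \<Delta> = "end_cone \<Gamma> x v"])
  show "(g \<circ> f) ` frontier \<Gamma> x u = frontier \<Gamma> x w"
    using assms by (simp only: image_comp[symmetric] colored_end_isomorphism_iff)
  show "\<chi> ((g \<circ> f) y) = \<chi> y" if "y \<in> verts (end_cone \<Gamma> x u)" for y
    using that colored_end_isomorphism_maps[OF assms(1) that]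
      colored_end_isomorphism_maps(2)[OF assms(2)] by simp
qed

lemma colored_end_isomorphism_id: "colored_end_isomorphism \<Gamma> x \<chi> id u u"
  by (simp add: colored_end_isomorphism_iff lgraph_iso_def case_prod_beta)

lemma colored_cone_equivI:
  "u \<in> verts \<Gamma> \<Longrightarrow> v \<in> verts \<Gamma> \<Longrightarrow> colored_end_isomorphism \<Gamma> x \<chi> f u v
    \<Longrightarrow> (u, v) \<in> colored_cone_equiv \<Gamma> x \<chi>"
  unfolding colored_cone_equiv_def by blast

lemma equiv_colored_cone_equiv:
  assumes "closed_edges \<Gamma>"
  shows "equiv (verts \<Gamma>) (colored_cone_equiv \<Gamma> x \<chi>)"
proof (rule equivI)
  show "colored_cone_equiv \<Gamma> x \<chi> \<subseteq> verts \<Gamma> \<times> verts \<Gamma>"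
    by (auto simp: colored_cone_equiv_def)
  show "refl_on (verts \<Gamma>) (colored_cone_equiv \<Gamma> x \<chi>)"
  proof (rule refl_onI)
    fix u assume "u \<in> verts \<Gamma>"
    moreover have "\<exists>f. colored_end_isomorphism \<Gamma> x \<chi> f u u"
      by (rule exI) (rule colored_end_isomorphism_id)
    ultimately show "(u, u) \<in> colored_cone_equiv \<Gamma> x \<chi>"
      by (simp add: colored_cone_equiv_def)
  qed
  show "sym (colored_cone_equiv \<Gamma> x \<chi>)"
  proof (rule symI)
    fix u v assume "(u, v) \<in> colored_cone_equiv \<Gamma> x \<chi>"
    then show "(v, u) \<in> colored_cone_equiv \<Gamma> x \<chi>"
      unfolding colored_cone_equiv_def
      using colored_end_isomorphism_inverse[OF assms, of u x \<chi> _ v] by blast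
  qed
  show "trans (colored_cone_equiv \<Gamma> x \<chi>)"
  proof (rule transI)
    fix u v w assume "(u, v) \<in> colored_cone_equiv \<Gamma> x \<chi>" "(v, w) \<in> colored_cone_equiv \<Gamma> x \<chi>"
    then show "(u, w) \<in> colored_cone_equiv \<Gamma> x \<chi>"
      unfolding colored_cone_equiv_def
      using colored_end_isomorphism_compose[of \<Gamma> x \<chi> _ u v _ w] by blast
  qed
qed

text \<open>The form in which finiteness passes from one graph to another: classes of end-cones are
  carried over as sets of vertices, each of which is then shown to lie in a single class.\<close>

lemma finite_quotientI:
  assumes "equiv V R" "finite \<P>" "V \<subseteq> \<Union>\<P>"
    and related: "\<And>P u v. P \<in> \<P> \<Longrightarrow> u \<in> P \<Longrightarrow> v \<in> P \<Longrightarrow> (u, v) \<in> R"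
  shows "finite (V // R)"
proof (rule finite_subset)
  show "V // R \<subseteq> (\<lambda>P. R `` P) ` \<P>"
  proof
    fix X assume "X \<in> V // R"
    then obtain u where u: "u \<in> V" "X = R `` {u}" by (auto simp: quotient_def)
    then obtain P where P: "P \<in> \<P>" "u \<in> P" using assms(3) by auto
    have "R `` {v} = R `` {u}" if "v \<in> P" for v
      using equiv_class_eq[OF assms(1) related[OF P(1) that P(2)]] .
    then have "R `` P = X" using P(2) u(2) by blast
    with P(1) show "X \<in> (\<lambda>P. R `` P) ` \<P>" by blast
  qed
  show "finite ((\<lambda>P. R `` P) ` \<P>)" using assms(2) by simp
qed

section \<open>Renaming vertices\<close>

definition rename :: "('v \<Rightarrow> 'w) \<Rightarrow> ('v, 'a) lgraph \<Rightarrow> ('w, 'a) lgraph" where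
  "rename f \<Gamma> = \<lparr>verts = f ` verts \<Gamma>, edges = (\<lambda>(u, a, w). (f u, a, f w)) ` edges \<Gamma>\<rparr>"

lemma verts_rename [simp]: "verts (rename f \<Gamma>) = f ` verts \<Gamma>"
  by (simp add: rename_def)

lemma edges_rename: "edges (rename f \<Gamma>) = (\<lambda>(u, a, w). (f u, a, f w)) ` edges \<Gamma>"
  by (simp add: rename_def)

lemma edges_rename_iff:
  "(u, a, w) \<in> edges (rename f \<Gamma>) \<longleftrightarrow> (\<exists>u' w'. u = f u' \<and> w = f w' \<and> (u', a, w') \<in> edges \<Gamma>)"
  by (force simp: rename_def)

lemma adj_rename_iff:
  "(u, w) \<in> adj (rename f \<Gamma>) \<longleftrightarrow> (\<exists>u' w'. u = f u' \<and> w = f w' \<and> (u', w') \<in> adj \<Gamma>)"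
  unfolding adj_def by (auto simp: edges_rename_iff)

lemma rtrancl_adj_rename_iff:
  assumes "inj f"
  shows "(f u, w) \<in> (adj (rename f \<Gamma>))\<^sup>* \<longleftrightarrow> (\<exists>w'. w = f w' \<and> (u, w') \<in> (adj \<Gamma>)\<^sup>*)"
proof
  assume "(f u, w) \<in> (adj (rename f \<Gamma>))\<^sup>*"
  then show "\<exists>w'. w = f w' \<and> (u, w') \<in> (adj \<Gamma>)\<^sup>*"
  proof (induction rule: rtrancl_induct)
    case base
    then show ?case by blast
  next
    case (step y z)
    then obtain y' y'' z' where "y = f y'" "(u, y') \<in> (adj \<Gamma>)\<^sup>*"
      "y = f y''" "z = f z'" "(y'', z') \<in> adj \<Gamma>" by (auto simp: adj_rename_iff)
    with assms show ?case by (auto dest: injD intro: rtrancl_into_rtrancl)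
  qed
next
  have "(f u, f w') \<in> (adj (rename f \<Gamma>))\<^sup>*" if "(u, w') \<in> (adj \<Gamma>)\<^sup>*" for w'
    using that
  proof (induction rule: rtrancl_induct)
    case base
    show ?case by simp
  next
    case (step y z)
    then have "(f y, f z) \<in> adj (rename f \<Gamma>)" by (auto simp: adj_rename_iff)
    with step.IH show ?case by (rule rtrancl_into_rtrancl)
  qed
  then show "\<exists>w'. w = f w' \<and> (u, w') \<in> (adj \<Gamma>)\<^sup>* \<Longrightarrow> (f u, w) \<in> (adj (rename f \<Gamma>))\<^sup>*"
    by auto
qed

lemma relpow_adj_rename_iff:
  assumes "inj f"
  shows "(f u, f w) \<in> adj (rename f \<Gamma>) ^^ n \<longleftrightarrow> (u, w) \<in> adj \<Gamma> ^^ n"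
proof (induction n arbitrary: w)
  case 0
  then show ?case using assms by (auto dest: injD)
next
  case (Suc n)
  have "(f u, f w) \<in> adj (rename f \<Gamma>) ^^ Suc n
    \<longleftrightarrow> (\<exists>y. (f u, f y) \<in> adj (rename f \<Gamma>) ^^ n \<and> (f y, f w) \<in> adj (rename f \<Gamma>))"
    by (auto simp: adj_rename_iff relcomp_unfold)
  also have "\<dots> \<longleftrightarrow> (\<exists>y. (u, y) \<in> adj \<Gamma> ^^ n \<and> (y, w) \<in> adj \<Gamma>)"
    using assms by (auto simp: Suc.IH adj_rename_iff dest: injD)
  also have "\<dots> \<longleftrightarrow> (u, w) \<in> adj \<Gamma> ^^ Suc n"
    by (auto simp: relcomp_unfold)
  finally show ?case .
qed

lemma path_dist_rename:
  "inj f \<Longrightarrow> path_dist (rename f \<Gamma>) (f u) (f w) = path_dist \<Gamma> u w"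
  by (simp add: path_dist_def relpow_adj_rename_iff)

lemma induced_subgraph_rename:
  "inj f \<Longrightarrow> induced_subgraph (rename f \<Gamma>) S = rename f (induced_subgraph \<Gamma> (f -` S))"
  by (intro lgraph.equality set_eqI) (auto simp: induced_subgraph_def edges_rename_iff inj_eq)

lemma end_cone_rename:
  fixes \<Gamma> :: "('v, 'a) lgraph"
  assumes "inj f"
  shows "end_cone (rename f \<Gamma>) (f x) (f v) = rename f (end_cone \<Gamma> x v)"
proof -
  have "component (rename f \<Delta>) (f v) = rename f (component \<Delta> v)" for \<Delta> :: "('v, 'a) lgraph"
    unfolding component_def induced_subgraph_rename[OF assms]
    by (rule arg_cong[where f = "\<lambda>S. rename f (induced_subgraph \<Delta> S)"])
      (use assms in \<open>auto simp: rtrancl_adj_rename_iff dest: injD\<close>)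
  then show ?thesis
    by (simp add: end_cone_def induced_subgraph_rename path_dist_rename vimage_def assms)
qed

lemma frontier_rename:
  "inj f \<Longrightarrow> frontier (rename f \<Gamma>) (f x) (f v) = f ` frontier \<Gamma> x v"
  by (auto simp: frontier_def end_cone_rename path_dist_rename)

lemma rooted_A_graph_rename:
  assumes f: "inj f" and "rooted_A_graph \<iota> A \<Gamma> x"
  shows "rooted_A_graph \<iota> A (rename f \<Gamma>) (f x)"
proof -
  from assms(2) have alph: "alphabet \<iota> A" and sub: "edges \<Gamma> \<subseteq> verts \<Gamma> \<times> A \<times> verts \<Gamma>"
    and sym: "\<And>u a w. (u, a, w) \<in> edges \<Gamma> \<Longrightarrow> (w, \<iota> a, u) \<in> edges \<Gamma>"
    and det: "\<And>u a w w'. (u, a, w) \<in> edges \<Gamma> \<Longrightarrow> (u, a, w') \<in> edges \<Gamma> \<Longrightarrow> w = w'"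
    and con: "\<And>u w. u \<in> verts \<Gamma> \<Longrightarrow> w \<in> verts \<Gamma> \<Longrightarrow> (u, w) \<in> (adj \<Gamma>)\<^sup>*"
    and root: "x \<in> verts \<Gamma>"
    unfolding rooted_A_graph_def A_graph_def by metis+
  show ?thesis
    unfolding rooted_A_graph_def A_graph_def
  proof (intro conjI allI impI ballI)
    show "edges (rename f \<Gamma>) \<subseteq> verts (rename f \<Gamma>) \<times> A \<times> verts (rename f \<Gamma>)"
      using sub by (auto simp: rename_def)
    fix u a w
    assume e: "(u, a, w) \<in> edges (rename f \<Gamma>)"
    then show "(w, \<iota> a, u) \<in> edges (rename f \<Gamma>)" using sym unfolding edges_rename_iff by blast
    fix w' assume "(u, a, w') \<in> edges (rename f \<Gamma>)"
    with e f show "w = w'" by (auto simp: edges_rename_iff dest: injD det)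
  next
    fix u w assume "u \<in> verts (rename f \<Gamma>)" "w \<in> verts (rename f \<Gamma>)"
    then show "(u, w) \<in> (adj (rename f \<Gamma>))\<^sup>*"
      using con by (auto simp: rtrancl_adj_rename_iff[OF f] inj_eq[OF f])
  qed (use alph root in auto)
qed

lemma colored_end_isomorphism_rename:
  assumes f: "inj f" and \<chi>': "\<And>v. \<chi>' (f v) = map_option c (\<chi> v)"
    and h: "colored_end_isomorphism \<Gamma> x \<chi> h u v"
  shows "colored_end_isomorphism (rename f \<Gamma>) (f x) \<chi>' (f \<circ> h \<circ> inv f) (f u) (f v)"
proof -
  have inv: "inv f (f y) = y" for y using f by simp
  from h have bij: "bij_betw h (verts (end_cone \<Gamma> x u)) (verts (end_cone \<Gamma> x v))"
    and e: "edges (end_cone \<Gamma> x v) = (\<lambda>(u, a, w). (h u, a, h w)) ` edges (end_cone \<Gamma> x u)"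
    and fr: "h ` frontier \<Gamma> x u = frontier \<Gamma> x v"
    by (simp_all add: colored_end_isomorphism_iff lgraph_iso_def)
  have "bij_betw (f \<circ> h \<circ> inv f) (f ` verts (end_cone \<Gamma> x u)) (f ` verts (end_cone \<Gamma> x v))"
  proof (intro bij_betw_trans)
    show "bij_betw (inv f) (f ` verts (end_cone \<Gamma> x u)) (verts (end_cone \<Gamma> x u))"
      using f by (intro bij_betw_byWitness[where f' = f]) auto
    show "bij_betw f (verts (end_cone \<Gamma> x v)) (f ` verts (end_cone \<Gamma> x v))"
      by (rule inj_on_imp_bij_betw[OF inj_on_subset[OF f subset_UNIV]])
  qed (rule bij)
  then show ?thesis
    using f colored_end_isomorphism_maps(2)[OF h]
    by (simp add: colored_end_isomorphism_iff end_cone_rename frontier_rename lgraph_iso_def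
        fr[symmetric] \<chi>' edges_rename e image_image inv case_prod_beta)
qed

lemma colored_context_free_rename:
  assumes "inj f" and "\<And>v. \<chi>' (f v) = map_option c (\<chi> v)"
    and "rooted_A_graph \<iota> A \<Gamma> x" and cf: "colored_context_free \<Gamma> x \<chi>"
  shows "colored_context_free (rename f \<Gamma>) (f x) \<chi>'"
  unfolding colored_context_free_iff
proof (rule finite_quotientI)
  let ?Q = "verts \<Gamma> // colored_cone_equiv \<Gamma> x \<chi>"
  have equiv: "equiv (verts \<Gamma>) (colored_cone_equiv \<Gamma> x \<chi>)"
    by (rule equiv_colored_cone_equiv[OF rooted_A_graph_closed_edges[OF assms(3)]])
  show "equiv (verts (rename f \<Gamma>)) (colored_cone_equiv (rename f \<Gamma>) (f x) \<chi>')"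
    by (rule equiv_colored_cone_equiv[OF rooted_A_graph_closed_edges[OF
          rooted_A_graph_rename[OF assms(1,3)]]])
  show "finite ((`) f ` ?Q)"
    using cf by (simp add: colored_context_free_iff)
  show "verts (rename f \<Gamma>) \<subseteq> \<Union> ((`) f ` ?Q)"
    using Union_quotient[OF equiv] by auto
  fix P u v assume "P \<in> (`) f ` ?Q" "u \<in> P" "v \<in> P"
  then obtain X u' v' where X: "X \<in> ?Q" "u' \<in> X" "v' \<in> X" and uv: "u = f u'" "v = f v'"
    by blast
  then have "(u', v') \<in> colored_cone_equiv \<Gamma> x \<chi>"
    by (intro in_quotient_imp_in_rel[OF equiv X(1)]) simp
  then obtain h where "u' \<in> verts \<Gamma>" "v' \<in> verts \<Gamma>" and h: "colored_end_isomorphism \<Gamma> x \<chi> h u' v'"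
    unfolding colored_cone_equiv_def by blast
  then show "(u, v) \<in> colored_cone_equiv (rename f \<Gamma>) (f x) \<chi>'"
    using colored_end_isomorphism_rename[where c = c, OF assms(1,2) h] unfolding uv
    by (intro colored_cone_equivI) simp_all
qed

lemma coloring_rename:
  assumes "inj f" "\<And>v. \<chi>' (f v) = map_option c (\<chi> v)" "\<And>z. z \<notin> range f \<Longrightarrow> \<chi>' z = None"
    and "coloring \<Gamma> x C \<chi>" "c ` C \<subseteq> C'"
  shows "coloring (rename f \<Gamma>) (f x) C' \<chi>'"
proof -
  have dom: "dom \<chi> = verts \<Gamma> - {x}" and ran: "ran \<chi> \<subseteq> C"
    using assms(4) by (simp_all add: coloring_def)
  have "dom \<chi>' = f ` dom \<chi>"
  proof (intro equalityI subsetI)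
    fix z assume z: "z \<in> dom \<chi>'"
    with assms(3) obtain v where v: "z = f v" by (cases "z \<in> range f") auto
    with z assms(2) have "v \<in> dom \<chi>" by auto
    with v show "z \<in> f ` dom \<chi>" by (rule image_eqI)
  qed (auto simp: assms(2))
  also have "\<dots> = f ` verts \<Gamma> - {f x}"
    unfolding dom by (simp add: image_set_diff[OF assms(1)])
  finally have "dom \<chi>' = verts (rename f \<Gamma>) - {f x}" by simp
  moreover have "ran \<chi>' \<subseteq> C'"
  proof
    fix b assume "b \<in> ran \<chi>'"
    then obtain z where z: "\<chi>' z = Some b" by (auto simp: ran_def)
    with assms(3) obtain v where "z = f v" by (cases "z \<in> range f") auto
    with z assms(2) obtain a where "\<chi> v = Some a" "b = c a" by auto
    with ran assms(5) show "b \<in> C'" by (auto simp: ran_def)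
  qed
  ultimately show ?thesis by (simp add: coloring_def)
qed

section \<open>Gluing pieces along a tree\<close>

text \<open>The pieces \<open>G i\<close> fall on two sides, each with its own alphabet. The color \<open>\<chi> i x\<close> is the
  index of the piece to be glued at \<open>x\<close>, and lies on the side opposite to \<open>i\<close>. A vertex alone
  determines the side of the pieces that contain it (\<open>vside\<close>), but pieces of the same side may
  share vertices.\<close>

locale alternating_gluing =
  fixes \<iota> :: "'a \<Rightarrow> 'a" and alph :: "bool \<Rightarrow> 'a set"
    and I :: "'i set" and side :: "'i \<Rightarrow> bool" and start :: "bool \<Rightarrow> 'i"
    and G :: "'i \<Rightarrow> ('x, 'a) lgraph" and r :: "'i \<Rightarrow> 'x" and vside :: "'x \<Rightarrow> bool"
    and \<chi> :: "'i \<Rightarrow> 'x \<rightharpoonup> 'i"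
  assumes alph: "alphabet \<iota> (alph b)"
    and alph_disjoint: "alph True \<inter> alph False = {}"
    and piece: "i \<in> I \<Longrightarrow> rooted_A_graph \<iota> (alph (side i)) (G i) (r i)"
    and vside: "i \<in> I \<Longrightarrow> x \<in> verts (G i) \<Longrightarrow> vside x = side i"
    and color: "i \<in> I \<Longrightarrow> coloring (G i) (r i) {j \<in> I. side j \<noteq> side i} (\<chi> i)"
    and start: "start b \<in> I" "side (start b) = b"
begin

inductive copy :: "'i \<Rightarrow> 'x list \<Rightarrow> bool" where
  init: "copy (start b) []"
| glue: "copy i p \<Longrightarrow> x \<in> verts (G i) - {r i} \<Longrightarrow> \<chi> i x = Some j \<Longrightarrow> copy j (x # p)"

definition spot :: "'i \<Rightarrow> 'x list \<Rightarrow> 'x \<Rightarrow> 'x list" where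
  "spot i p x = (if x = r i then p else x # p)"

definition product :: "('x list, 'a) lgraph" where
  "product =
    \<lparr>verts = {spot i p x | i p x. copy i p \<and> x \<in> verts (G i)},
     edges = {(spot i p x, a, spot i p y) | i p x a y. copy i p \<and> (x, a, y) \<in> edges (G i)}\<rparr>"

lemma edge_in_piece: "i \<in> I \<Longrightarrow> (x, a, y) \<in> edges (G i)
    \<Longrightarrow> x \<in> verts (G i) \<and> a \<in> alph (side i) \<and> y \<in> verts (G i)"
  using piece[of i] by (auto simp: rooted_A_graph_def A_graph_def)

lemma adj_in_piece: "i \<in> I \<Longrightarrow> (x, y) \<in> adj (G i) \<Longrightarrow> x \<in> verts (G i) \<and> y \<in> verts (G i)"
  using edge_in_piece[of i] by (meson adjE)

lemma root_in_piece: "i \<in> I \<Longrightarrow> r i \<in> verts (G i)"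
  using piece[of i] by (simp add: rooted_A_graph_def)

lemma piece_reachable: "i \<in> I \<Longrightarrow> x \<in> verts (G i) \<Longrightarrow> (r i, x) \<in> (adj (G i))\<^sup>*"
  using piece[of i] by (rule rooted_A_graph_reachable)

lemma piece_closed: "i \<in> I \<Longrightarrow> closed_edges (G i)"
  using piece[of i] by (rule rooted_A_graph_closed_edges)

lemma color_SomeD: "i \<in> I \<Longrightarrow> \<chi> i x = Some j \<Longrightarrow> j \<in> I \<and> side j \<noteq> side i"
  using color[of i] ranI[of "\<chi> i" x j] by (auto simp: coloring_def)

lemma copy_Cons_iff:
  "copy j (x # p) \<longleftrightarrow> (\<exists>i. copy i p \<and> x \<in> verts (G i) - {r i} \<and> \<chi> i x = Some j)"
  by (auto elim: copy.cases intro: glue)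

lemma copy_Nil_iff: "copy i [] \<longleftrightarrow> (\<exists>b. i = start b)"
  by (auto elim: copy.cases intro: init)

lemma copy_index: "copy i p \<Longrightarrow> i \<in> I"
  by (induction rule: copy.induct) (use start color_SomeD in blast)+

text \<open>The copy glued at a vertex and the copy in which that vertex is a non-root vertex lie on
  opposite sides. All uniqueness statements about positions rest on this alternation.\<close>

lemma copy_side: "copy j (x # p) \<Longrightarrow> side j \<noteq> vside x"
  unfolding copy_Cons_iff using copy_index color_SomeD vside by (metis DiffD1)

lemma copy_unique: "copy i p \<Longrightarrow> copy j p \<Longrightarrow> side i = side j \<Longrightarrow> i = j"
proof (induction p arbitrary: i j)
  case Nil
  then obtain b c where "i = start b" "j = start c" by (auto simp: copy_Nil_iff)
  moreover from this have "b = c" using Nil(3) start(2)[of b] start(2)[of c] by (simp only:)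
  ultimately show ?case by simp
next
  case (Cons x p)
  then obtain i' j' where i': "copy i' p" "x \<in> verts (G i')" "\<chi> i' x = Some i"
    and j': "copy j' p" "x \<in> verts (G j')" "\<chi> j' x = Some j"
    unfolding copy_Cons_iff by blast
  have "side i' = side j'"
    using vside[OF copy_index[OF i'(1)] i'(2)] vside[OF copy_index[OF j'(1)] j'(2)] by simp
  then have "i' = j'" by (rule Cons.IH[OF i'(1) j'(1)])
  with i'(3) j'(3) show ?case by simp
qed

lemma copy_piece_unique:
  "copy i p \<Longrightarrow> copy j p \<Longrightarrow> x \<in> verts (G i) \<Longrightarrow> x \<in> verts (G j) \<Longrightarrow> i = j"
  using copy_unique[of i p j] vside[of i x] vside[of j x] copy_index[of i p] copy_index[of j p]
  by simp

lemma spot_in_verts: "copy i p \<Longrightarrow> x \<in> verts (G i) \<Longrightarrow> spot i p x \<in> verts product"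
  by (auto simp: product_def)

lemma spot_root [simp]: "spot i p (r i) = p"
  by (simp add: spot_def)

lemma copy_in_verts: "copy i p \<Longrightarrow> p \<in> verts product"
  using spot_in_verts[of i p "r i"] root_in_piece[OF copy_index] by simp

lemma Nil_in_verts: "[] \<in> verts product"
  using copy_in_verts[OF init] .

lemma Cons_in_verts_iff:
  "x # p \<in> verts product \<longleftrightarrow> (\<exists>i. copy i p \<and> x \<in> verts (G i) - {r i})"
proof
  assume "x # p \<in> verts product"
  then obtain i p' y where *: "x # p = spot i p' y" "copy i p'" "y \<in> verts (G i)"
    by (auto simp: product_def)
  show "\<exists>i. copy i p \<and> x \<in> verts (G i) - {r i}"
  proof (cases "y = r i")
    case True
    with * have "copy i (x # p)" by simp
    then show ?thesis unfolding copy_Cons_iff by blast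
  next
    case False
    with * show ?thesis by (auto simp: spot_def)
  qed
next
  assume "\<exists>i. copy i p \<and> x \<in> verts (G i) - {r i}"
  then obtain i where "copy i p" "x \<in> verts (G i)" "x \<noteq> r i" by blast
  with spot_in_verts[of i p x] show "x # p \<in> verts product" by (simp add: spot_def)
qed

lemma edges_product_iff:
  "(u, a, w) \<in> edges product \<longleftrightarrow>
    (\<exists>i p x y. copy i p \<and> (x, a, y) \<in> edges (G i) \<and> u = spot i p x \<and> w = spot i p y)"
  by (auto simp: product_def)

lemma adj_product_iff:
  "(u, w) \<in> adj product \<longleftrightarrow>
    (\<exists>i p x y. copy i p \<and> (x, y) \<in> adj (G i) \<and> u = spot i p x \<and> w = spot i p y)"
  unfolding adj_def mem_Collect_eq case_prod_conv edges_product_iff by blast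

lemma closed_edges_product: "closed_edges product"
proof -
  have "u \<in> verts product \<and> w \<in> verts product" if "(u, a, w) \<in> edges product" for u a w
    using that edge_in_piece[OF copy_index] unfolding edges_product_iff
    by (blast intro: spot_in_verts)
  then show ?thesis by (auto simp: closed_edges_def)
qed

section \<open>Distances in the product\<close>

abbreviation depth :: "'i \<Rightarrow> 'x \<Rightarrow> nat" where
  "depth i x \<equiv> path_dist (G i) (r i) x"

text \<open>The description \<open>THE i\<close> picks the copy, among those glued at \<open>p\<close>, to which the letter \<open>x\<close>
  belongs. At the root two copies are glued, so the side of \<open>x\<close> is needed to choose.\<close>

primrec height :: "'x list \<Rightarrow> nat" where
  "height [] = 0"
| "height (x # p) = height p + depth (THE i. copy i p \<and> side i = vside x) x"

lemma height_Cons: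
  assumes "copy i p" "x \<in> verts (G i)"
  shows "height (x # p) = height p + depth i x"
proof -
  have "side i = vside x" using vside[OF copy_index] assms by simp
  with assms have "(THE i. copy i p \<and> side i = vside x) = i"
    by (intro the_equality) (auto intro: copy_unique)
  then show ?thesis by simp
qed

lemma height_spot: "copy i p \<Longrightarrow> x \<in> verts (G i) \<Longrightarrow> height (spot i p x) = height p + depth i x"
  using height_Cons[of i p x] by (simp add: spot_def del: height.simps)

lemma depth_pos: "i \<in> I \<Longrightarrow> x \<in> verts (G i) \<Longrightarrow> x \<noteq> r i \<Longrightarrow> 0 < depth i x"
  using path_dist_eq_0[OF piece_reachable] by blast

lemma
  assumes "v \<in> verts product"
  shows product_reachable: "([], v) \<in> (adj product)\<^sup>*"
    and path_dist_product: "path_dist product [] v = height v"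
proof -
  have zero: "v = []" if v: "v \<in> verts product" "height v = 0" for v
  proof (cases v)
    case (Cons x p)
    with v obtain i where i: "copy i p" "x \<in> verts (G i)" "x \<noteq> r i"
      by (auto simp: Cons_in_verts_iff)
    with v(2) depth_pos[OF copy_index[OF i(1)] i(2,3)] show ?thesis
      unfolding Cons height_Cons[OF i(1,2)] by simp
  qed
  have step: "height w \<le> Suc (height u)" if uw: "(u, w) \<in> adj product" for u w
  proof -
    from uw obtain i p x y
      where i: "copy i p" "(x, y) \<in> adj (G i)" "u = spot i p x" "w = spot i p y"
      unfolding adj_product_iff by blast
    note I = copy_index[OF i(1)]
    have xy: "x \<in> verts (G i)" "y \<in> verts (G i)" using adj_in_piece[OF I i(2)] by simp_all
    from path_dist_step[OF piece_reachable[OF I xy(1)] i(2)] show ?thesis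
      by (simp add: i(3,4) height_spot[OF i(1)] xy)
  qed
  have descend: "\<exists>u\<in>verts product. (u, v) \<in> adj product \<and> height u = n"
    if v: "v \<in> verts product" "height v = Suc n" for v n
  proof -
    from v obtain x p where vx: "v = x # p" by (cases v) auto
    with v(1) obtain i where i: "copy i p" "x \<in> verts (G i)" "x \<noteq> r i"
      by (auto simp: Cons_in_verts_iff)
    note I = copy_index[OF i(1)]
    obtain m where m: "depth i x = Suc m"
      using depth_pos[OF I i(2,3)] gr0_implies_Suc by blast
    from path_dist_predecessor[OF piece_reachable[OF I i(2)] m] obtain y
      where y: "(y, x) \<in> adj (G i)" "depth i y = m" .
    have yv: "y \<in> verts (G i)" using adj_in_piece[OF I y(1)] by simp
    have "(spot i p y, v) \<in> adj product"
      unfolding adj_product_iff using i y(1) by (auto simp: vx spot_def)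
    moreover have "height (spot i p y) = n"
      using v(2) m y(2) unfolding vx height_Cons[OF i(1,2)] height_spot[OF i(1) yv] by simp
    ultimately show ?thesis
      using spot_in_verts[OF i(1) yv] by blast
  qed
  show "([], v) \<in> (adj product)\<^sup>*"
    by (rule path_dist_eqI(1)[where h = height, OF height.simps(1) zero step descend assms])
  show "path_dist product [] v = height v"
    by (rule path_dist_eqI(2)[where h = height, OF height.simps(1) zero step descend assms])
qed

text \<open>The alternation of sides excludes that a vertex is both the root of one copy and a non-root
  vertex of another copy on the same side. Hence all edges with a given label at a given vertex
  belong to one copy, their label determining its side, and the product is deterministic because
  each piece is.\<close>

lemma spot_eqD:
  assumes "copy i p" "copy j q" "side i = side j" "x \<in> verts (G i)" "y \<in> verts (G j)"
    and eq: "spot i p x = spot j q y"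
  shows "i = j \<and> p = q \<and> x = y"
proof -
  have "vside x = side i" "vside y = side j"
    using vside[OF copy_index] assms by blast+
  then have "x = r i \<longleftrightarrow> y = r j"
    using eq copy_side[of i y q] copy_side[of j x p] assms(1-3) by (auto simp: spot_def split: if_splits)
  with eq have "p = q \<and> (x = y \<or> x = r i \<and> y = r j)" by (auto simp: spot_def split: if_splits)
  with copy_unique[OF assms(1) _ assms(3)] assms(2) show ?thesis by auto
qed

lemma rooted_A_graph_product: "rooted_A_graph \<iota> (alph True \<union> alph False) product []"
proof -
  have edge: "a \<in> alph (side i)" "x \<in> verts (G i)" "(y, \<iota> a, x) \<in> edges (G i)"
    if "copy i p" "(x, a, y) \<in> edges (G i)" for i p x a y
    using edge_in_piece[OF copy_index[OF that(1)] that(2)] piece[OF copy_index[OF that(1)]] that(2)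
    by (auto simp: rooted_A_graph_def A_graph_def)
  have inverse: "(w, \<iota> a, u) \<in> edges product" if "(u, a, w) \<in> edges product" for u a w
    using that edge(3) unfolding edges_product_iff by blast
  show ?thesis
    unfolding rooted_A_graph_def A_graph_def
  proof (intro conjI allI impI ballI)
    show "alphabet \<iota> (alph True \<union> alph False)"
      using alph[of True] alph[of False] by (auto simp: alphabet_def)
    show "edges product \<subseteq> verts product \<times> (alph True \<union> alph False) \<times> verts product"
    proof
      fix e assume e: "e \<in> edges product"
      obtain u a w where uaw: "e = (u, a, w)" by (cases e)
      with e obtain i p x y where "copy i p" "(x, a, y) \<in> edges (G i)"
        by (auto simp: edges_product_iff)
      then have "a \<in> alph (side i)" by (rule edge(1))
      then have "a \<in> alph True \<union> alph False" by (cases "side i") auto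
      then show "e \<in> verts product \<times> (alph True \<union> alph False) \<times> verts product"
        using closed_edges_product e uaw by (auto simp: closed_edges_def)
    qed
    fix u a w assume e: "(u, a, w) \<in> edges product"
    then show "(w, \<iota> a, u) \<in> edges product" by (rule inverse)
    fix w' assume e': "(u, a, w') \<in> edges product"
    from e obtain i p x y where 1: "copy i p" "(x, a, y) \<in> edges (G i)" "u = spot i p x" "w = spot i p y"
      unfolding edges_product_iff by blast
    from e' obtain j q x' y' where 2: "copy j q" "(x', a, y') \<in> edges (G j)" "u = spot j q x'" "w' = spot j q y'"
      unfolding edges_product_iff by blast
    have "side i = side j"
      using edge(1)[OF 1(1,2)] edge(1)[OF 2(1,2)] alph_disjoint by (cases "side i"; cases "side j") auto
    from spot_eqD[OF 1(1) 2(1) this edge(2)[OF 1(1,2)] edge(2)[OF 2(1,2)]] 1(3) 2(3)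
    have "i = j" "p = q" "x = x'" by simp_all
    moreover from this have "y = y'"
      using piece[OF copy_index[OF 1(1)]] 1(2) 2(2) unfolding rooted_A_graph_def A_graph_def by blast
    ultimately show "w = w'" using 1(4) 2(4) by simp
  next
    have sym: "sym (adj product)"
      using inverse by (auto simp: sym_def adj_def)
    fix u w assume "u \<in> verts product" "w \<in> verts product"
    then have "(u, []) \<in> (adj product)\<^sup>*" "([], w) \<in> (adj product)\<^sup>*"
      using product_reachable symD[OF sym_rtrancl[OF sym]] by blast+
    then show "(u, w) \<in> (adj product)\<^sup>*" by (rule rtrancl_trans)
  qed (rule Nil_in_verts)
qed

section \<open>End-cones of the product\<close>

lemma height_append: "height w \<le> height (q @ w)"
  by (induction q) auto

lemma height_append_eq:
  assumes "q @ w \<in> verts product" "height (q @ w) = height w"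
  shows "q = []"
proof (cases q)
  case (Cons z q')
  with assms(1) obtain j where j: "copy j (q' @ w)" "z \<in> verts (G j)" "z \<noteq> r j"
    by (auto simp: Cons_in_verts_iff)
  have "height (q @ w) = height (q' @ w) + depth j z"
    unfolding Cons append_Cons by (rule height_Cons[OF j(1,2)])
  with assms(2) depth_pos[OF copy_index[OF j(1)] j(2,3)] height_append[of w q'] show ?thesis
    by simp
qed

text \<open>A copy that meets the part hanging from \<open>y # p\<close> is either glued inside that part, and then
  lies in it entirely, or is the copy at \<open>p\<close> that contains \<open>y\<close>.\<close>

lemma spot_eq_append_Cons:
  assumes "spot j p' b = q @ y # p"
  shows "(\<exists>q'. p' = q' @ y # p) \<or> p' = p \<and> b = y \<and> b \<noteq> r j \<and> q = []"
  using assms by (cases q) (auto simp: spot_def split: if_splits)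

lemma adj_upper_part_product:
  assumes "v \<in> verts product"
  shows "(u, w) \<in> adj (upper_part product [] v) \<longleftrightarrow>
    (u, w) \<in> adj product \<and> height v \<le> height u \<and> height v \<le> height w"
proof -
  have "u \<in> verts product \<and> w \<in> verts product" if "(u, w) \<in> adj product"
    using that closed_edges_product by (auto simp: closed_edges_def elim!: adjE)
  then show ?thesis
    unfolding adj_upper_part using path_dist_product assms by auto
qed

text \<open>No copy glued at \<open>w\<close> has a vertex closer to the root than \<open>w\<close>, so such a copy is traversed
  without leaving the upper part.\<close>

lemma upper_part_climb:
  assumes "v \<in> verts product" "copy j w" "height v \<le> height w" "z \<in> verts (G j)"
  shows "(w, spot j w z) \<in> (adj (upper_part product [] v))\<^sup>*"
  using piece_reachable[OF copy_index[OF assms(2)] assms(4)]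
proof (induction rule: rtrancl_induct)
  case base
  show ?case by simp
next
  case (step y z)
  have "(spot j w y, spot j w z) \<in> adj product"
    unfolding adj_product_iff using assms(2) step.hyps(2) by blast
  moreover have "y \<in> verts (G j)" "z \<in> verts (G j)"
    using adj_in_piece[OF copy_index[OF assms(2)] step.hyps(2)] by simp_all
  ultimately have "(spot j w y, spot j w z) \<in> adj (upper_part product [] v)"
    unfolding adj_upper_part_product[OF assms(1)] using assms(2,3) by (simp add: height_spot)
  with step.IH show ?case by (rule rtrancl_into_rtrancl)
qed

abbreviation cone :: "'i \<Rightarrow> 'x \<Rightarrow> 'x set" where
  "cone i x \<equiv> verts (end_cone (G i) (r i) x)"

definition hanging :: "'i \<Rightarrow> 'x list \<Rightarrow> 'x \<Rightarrow> 'x list set" where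
  "hanging i p x = {q @ y # p | q y. y \<in> cone i x \<and> q @ y # p \<in> verts product}"

definition non_root :: "'i \<Rightarrow> 'x list \<Rightarrow> 'x \<Rightarrow> bool" where
  "non_root i p x \<longleftrightarrow> copy i p \<and> x \<in> verts (G i) \<and> x \<noteq> r i"

lemma non_rootD:
  assumes "non_root i p x"
  shows "copy i p" "i \<in> I" "x \<in> verts (G i)" "x \<noteq> r i" "x # p \<in> verts product"
    "spot i p x = x # p" "height (x # p) = height p + depth i x"
  using assms copy_index[of i p] height_Cons[of i p x]
  by (auto simp: non_root_def Cons_in_verts_iff spot_def simp del: height.simps)

lemma cone_level:
  assumes "non_root i p x" "y \<in> cone i x"
  shows "non_root i p y" and "depth i x \<le> depth i y"
proof -
  note x = non_rootD[OF assms(1)]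
  note y = end_cone_level[OF piece_closed[OF x(2)] x(3) assms(2)]
  show "depth i x \<le> depth i y" by (rule y(2))
  then have "y \<noteq> r i" using depth_pos[OF x(2-4)] by auto
  with x(1) y(1) show "non_root i p y" by (simp add: non_root_def)
qed

text \<open>An edge can leave the part hanging from the cone of \<open>x\<close> only within the copy at \<open>p\<close>, and
  there the height condition of the product is the condition that defines the cone of \<open>x\<close> in its
  piece.\<close>

lemma end_cone_in_hanging:
  assumes x: "non_root i p x" and w: "(x # p, w) \<in> (adj (upper_part product [] (x # p)))\<^sup>*"
  shows "w \<in> hanging i p x"
  using w
proof (induction rule: rtrancl_induct)
  case base
  have "x \<in> cone i x"
    unfolding verts_end_cone[OF piece_closed[OF non_rootD(2)[OF x]] non_rootD(3)[OF x]] by simp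
  then show ?case using non_rootD(5)[OF x] by (force simp: hanging_def)
next
  case (step u w)
  note xD = non_rootD[OF x]
  from step.hyps(2) have uw: "(u, w) \<in> adj product" and hw: "height (x # p) \<le> height w"
    unfolding adj_upper_part_product[OF xD(5)] by simp_all
  from uw obtain j p' b c where j: "copy j p'" "(b, c) \<in> adj (G j)" "u = spot j p' b" "w = spot j p' c"
    unfolding adj_product_iff by blast
  note bc = adj_in_piece[OF copy_index[OF j(1)] j(2)]
  from step.IH obtain q y where y: "y \<in> cone i x" "u = q @ y # p"
    by (auto simp: hanging_def)
  have wv: "w \<in> verts product" using j(1,4) bc by (simp add: spot_in_verts)
  from spot_eq_append_Cons[of j p' b q y p] j(3) y(2)
  consider (above) q' where "p' = q' @ y # p" | (same) "p' = p" "b = y" "b \<noteq> r j" by auto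
  then show ?case
  proof cases
    case above
    then have "w = q' @ y # p \<or> w = (c # q') @ y # p" using j(4) by (simp add: spot_def)
    with y(1) wv show ?thesis unfolding hanging_def by blast
  next
    case same
    have "j = i"
      using copy_piece_unique[of j p i y] j(1) xD(1) bc same cone_level(1)[OF x y(1)]
      by (simp add: non_root_def)
    have "height w = height p + depth i c"
      using height_spot[OF j(1)] bc j(4) by (simp add: same \<open>j = i\<close>)
    with hw have d: "depth i x \<le> depth i c" unfolding xD(7) by simp
    have "(y, c) \<in> adj (upper_part (G i) (r i) x)"
      using j(2) d cone_level(2)[OF x y(1)] by (simp add: adj_upper_part same \<open>j = i\<close>)
    with y(1) have c: "c \<in> cone i x"
      unfolding verts_end_cone[OF piece_closed[OF xD(2)] xD(3)]
      by (auto intro: rtrancl_into_rtrancl)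
    then have "w = [] @ c # p"
      using non_rootD(6)[OF cone_level(1)[OF x c]] j(4) by (simp add: same \<open>j = i\<close>)
    with c wv show ?thesis unfolding hanging_def by blast
  qed
qed

text \<open>Conversely, a word \<open>q @ y # p\<close> is reached by first crossing the copy at \<open>p\<close> from \<open>x\<close> to
  \<open>y\<close> inside the cone, then climbing through the copies along \<open>q\<close>.\<close>

lemma hanging_in_end_cone:
  assumes x: "non_root i p x" and w: "w \<in> hanging i p x"
  shows "(x # p, w) \<in> (adj (upper_part product [] (x # p)))\<^sup>*"
proof -
  note xD = non_rootD[OF x]
  let ?U = "adj (upper_part product [] (x # p))"
  have across: "(x # p, y # p) \<in> ?U\<^sup>*" if "y \<in> cone i x" for y
  proof -
    from that have "(x, y) \<in> (adj (upper_part (G i) (r i) x))\<^sup>*"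
      unfolding verts_end_cone[OF piece_closed[OF xD(2)] xD(3)] by simp
    then show ?thesis
    proof (induction rule: rtrancl_induct)
      case base
      show ?case by simp
    next
      case (step y z)
      have yz: "y \<in> cone i x" "z \<in> cone i x"
        unfolding verts_end_cone[OF piece_closed[OF xD(2)] xD(3)]
        using step.hyps by (auto intro: rtrancl_into_rtrancl)
      note y = non_rootD[OF cone_level(1)[OF x yz(1)]]
      note z = non_rootD[OF cone_level(1)[OF x yz(2)]]
      have "(y, z) \<in> adj (G i)" using step.hyps(2) by (simp add: adj_upper_part)
      then have "(y # p, z # p) \<in> adj product"
        unfolding adj_product_iff using y(1,6) z(6) by metis
      then have "(y # p, z # p) \<in> ?U"
        unfolding adj_upper_part_product[OF xD(5)]
        using cone_level(2)[OF x yz(1)] cone_level(2)[OF x yz(2)] xD(7) y(7) z(7) by simp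
      with step.IH show ?case by (rule rtrancl_into_rtrancl)
    qed
  qed
  have up: "(y # p, q @ y # p) \<in> ?U\<^sup>*" if y: "y \<in> cone i x" and "q @ y # p \<in> verts product" for q y
    using that(2)
  proof (induction q)
    case Nil
    show ?case by simp
  next
    case (Cons z q)
    then obtain j where j: "copy j (q @ y # p)" "z \<in> verts (G j)" "z \<noteq> r j"
      by (auto simp: Cons_in_verts_iff)
    have "height (x # p) \<le> height (y # p)"
      using cone_level(2)[OF x y] non_rootD(7)[OF cone_level(1)[OF x y]] xD(7) by simp
    also have "\<dots> \<le> height (q @ y # p)" by (rule height_append)
    finally have "(q @ y # p, spot j (q @ y # p) z) \<in> ?U\<^sup>*"
      by (rule upper_part_climb[OF xD(5) j(1) _ j(2)])
    with Cons.IH[OF copy_in_verts[OF j(1)]] j(3) show ?case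
      by (simp add: spot_def)
  qed
  from w obtain q y where "y \<in> cone i x" "w = q @ y # p" "q @ y # p \<in> verts product"
    by (auto simp: hanging_def)
  with rtrancl_trans[OF across up] show ?thesis by simp
qed

lemma verts_end_cone_product:
  assumes "non_root i p x"
  shows "verts (end_cone product [] (x # p)) = hanging i p x"
  unfolding verts_end_cone[OF closed_edges_product non_rootD(5)[OF assms]]
  using end_cone_in_hanging[OF assms] hanging_in_end_cone[OF assms] by blast

text \<open>Each letter of \<open>q\<close> adds a positive amount to the height, so frontier vertices have \<open>q = []\<close>.\<close>

lemma frontier_product:
  assumes x: "non_root i p x"
  shows "frontier product [] (x # p) = (\<lambda>y. y # p) ` frontier (G i) (r i) x"
proof -
  note xD = non_rootD[OF x]
  have level: "height (y # p) = height (x # p) \<longleftrightarrow> depth i y = depth i x"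
    if "y \<in> cone i x" for y
    using non_rootD(7)[OF cone_level(1)[OF x that]] xD(7) by simp
  have bottom: "q = [] \<and> depth i y = depth i x"
    if y: "y \<in> cone i x" and v: "q @ y # p \<in> verts product" and h: "height (q @ y # p) = height (x # p)"
    for q y
  proof -
    have "height (x # p) \<le> height (y # p)"
      using cone_level(2)[OF x y] non_rootD(7)[OF cone_level(1)[OF x y]] xD(7) by simp
    with h height_append[of "y # p" q] have "height (q @ y # p) = height (y # p)" by simp
    with height_append_eq[OF v] h level[OF y] show ?thesis by simp
  qed
  have "frontier product [] (x # p) = {u \<in> hanging i p x. height u = height (x # p)}"
    unfolding frontier_def verts_end_cone_product[OF x]
    using path_dist_product xD(5) by (auto simp: hanging_def)
  also have "\<dots> = (\<lambda>y. y # p) ` {y \<in> cone i x. depth i y = depth i x}"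
  proof (intro equalityI subsetI)
    fix u assume "u \<in> {u \<in> hanging i p x. height u = height (x # p)}"
    then obtain q y where y: "y \<in> cone i x" "u = q @ y # p" "q @ y # p \<in> verts product"
      "height (q @ y # p) = height (x # p)" by (auto simp: hanging_def)
    from bottom[OF y(1,3,4)] y(1,2) show "u \<in> (\<lambda>y. y # p) ` {y \<in> cone i x. depth i y = depth i x}"
      by simp
  next
    fix u assume "u \<in> (\<lambda>y. y # p) ` {y \<in> cone i x. depth i y = depth i x}"
    then obtain y where y: "y \<in> cone i x" "depth i y = depth i x" "u = [] @ y # p" by auto
    have "u \<in> hanging i p x"
      using y(1,3) non_rootD(5)[OF cone_level(1)[OF x y(1)]] unfolding hanging_def by auto
    with y(2,3) level[OF y(1)] show "u \<in> {u \<in> hanging i p x. height u = height (x # p)}"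
      by simp
  qed
  finally show ?thesis by (simp add: frontier_def)
qed

section \<open>Isomorphisms between end-cones of the product\<close>

text \<open>Exchanges the bottom part \<open>y # p\<close> of a word \<open>q @ y # p\<close> for \<open>f y # p'\<close>. The letter \<open>y\<close> is
  located by its distance from the end of the word, since \<open>p\<close> is a fixed suffix.\<close>

definition move :: "('x \<Rightarrow> 'x) \<Rightarrow> 'x list \<Rightarrow> 'x list \<Rightarrow> 'x list \<Rightarrow> 'x list" where
  "move f p p' w =
    (let n = length w - Suc (length p) in take n w @ f (w ! n) # p')"

lemma move_append [simp]: "move f p p' (q @ y # p) = q @ f y # p'"
  by (simp add: move_def nth_append)

lemma move_Cons [simp]: "move f p p' (y # p) = f y # p'"
  using move_append[of f p p' "[]"] by simp

lemma move_spot: "move f p p' (spot j (q @ y # p) b) = spot j (q @ f y # p') b"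
  using move_append[of f p p' "b # q"] by (simp add: spot_def)

context
  fixes i p p' x x' f
  assumes x: "non_root i p x" and x': "non_root i p' x'"
    and f: "colored_end_isomorphism (G i) (r i) (\<chi> i) f x x'"
begin

text \<open>What is glued at \<open>f y # p'\<close> is what is glued at \<open>y # p\<close>, since \<open>f\<close> preserves colors; above
  that, both parts grow by the same rules.\<close>

lemma copy_move:
  assumes y: "y \<in> cone i x" and "copy j (q @ y # p)"
  shows "copy j (q @ f y # p')"
  using assms(2)
proof (induction q arbitrary: j)
  case Nil
  then obtain j' where j': "copy j' p" "y \<in> verts (G j')" "\<chi> j' y = Some j"
    by (auto simp: copy_Cons_iff)
  moreover have "j' = i"
    using copy_piece_unique[of j' p i y] j'(1,2) cone_level(1)[OF x y] by (simp add: non_root_def)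
  ultimately have "\<chi> i (f y) = Some j"
    using colored_end_isomorphism_maps(2)[OF f y] by simp
  moreover have "non_root i p' (f y)"
    by (rule cone_level(1)[OF x' colored_end_isomorphism_maps(1)[OF f y]])
  ultimately show ?case by (auto simp: copy_Cons_iff non_root_def)
next
  case (Cons z q)
  then show ?case by (auto simp: copy_Cons_iff)
qed

lemma move_in_hanging:
  assumes "u \<in> hanging i p x"
  shows "move f p p' u \<in> hanging i p' x'"
proof -
  from assms obtain q y where y: "y \<in> cone i x" "u = q @ y # p" "q @ y # p \<in> verts product"
    by (auto simp: hanging_def)
  note fy = colored_end_isomorphism_maps(1)[OF f y(1)]
  have "q @ f y # p' \<in> verts product"
  proof (cases q)
    case Nil
    then show ?thesis using non_rootD(5)[OF cone_level(1)[OF x' fy]] by simp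
  next
    case (Cons z q')
    with y(3) obtain j where "copy j (q' @ y # p)" "z \<in> verts (G j) - {r j}"
      by (auto simp: Cons_in_verts_iff)
    with copy_move[OF y(1)] show ?thesis
      unfolding Cons append_Cons Cons_in_verts_iff by blast
  qed
  with fy show ?thesis unfolding y(2) move_append hanging_def by blast
qed

lemma move_edge:
  assumes u: "u \<in> hanging i p x" and w: "w \<in> hanging i p x" and uw: "(u, a, w) \<in> edges product"
  shows "(move f p p' u, a, move f p p' w) \<in> edges product"
proof -
  note xD = non_rootD[OF x]
  from uw obtain j p0 b c
    where j: "copy j p0" "(b, a, c) \<in> edges (G j)" "u = spot j p0 b" "w = spot j p0 c"
    unfolding edges_product_iff by blast
  from u obtain q y where y: "y \<in> cone i x" "u = q @ y # p" by (auto simp: hanging_def)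
  from spot_eq_append_Cons[of j p0 b q y p] j(3) y(2)
  consider (above) q' where "p0 = q' @ y # p" | (same) "p0 = p" "b = y" "b \<noteq> r j" by auto
  then show ?thesis
  proof cases
    case above
    with copy_move[OF y(1)] j(1) have "copy j (q' @ f y # p')" by simp
    with j(2) show ?thesis
      unfolding edges_product_iff j(3,4) above move_spot by blast
  next
    case same
    have "j = i"
      using copy_piece_unique[of j p i y] j(1) xD(1) edge_in_piece[OF copy_index[OF j(1)] j(2)]
        same cone_level(1)[OF x y(1)] by (simp add: non_root_def)
    from w obtain q' z where z: "z \<in> cone i x" "w = q' @ z # p" by (auto simp: hanging_def)
    with j(4) have c: "c = z" "c \<noteq> r i"
      by (auto simp: same \<open>j = i\<close> spot_def Cons_eq_append_conv split: if_splits)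
    have "(y, a, z) \<in> edges (end_cone (G i) (r i) x)"
      unfolding edges_end_cone[OF piece_closed[OF xD(2)] xD(3)]
      using j(2) y(1) z(1) by (simp add: same \<open>j = i\<close> c)
    then have "(f y, a, f z) \<in> edges (end_cone (G i) (r i) x')"
      using f by (auto simp: colored_end_isomorphism_iff intro: lgraph_iso_edge)
    then have e: "(f y, a, f z) \<in> edges (G i)"
      unfolding edges_end_cone[OF piece_closed[OF xD(2)] non_rootD(3)[OF x']] by simp
    have "spot i p' (f y) = f y # p'" "spot i p' (f z) = f z # p'"
      by (intro non_rootD(6)[OF cone_level(1)[OF x']] colored_end_isomorphism_maps(1)[OF f] y z)+
    moreover have "u = y # p" "w = z # p"
      using j(3,4) same c by (simp_all add: spot_def \<open>j = i\<close>)
    ultimately show ?thesis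
      unfolding edges_product_iff using e non_rootD(1)[OF x'] by (metis move_Cons)
  qed
qed

end

text \<open>The hypotheses on \<open>f\<close> are symmetric, its inverse being a colored end-isomorphism as well, so
  the one-sided statements above, applied to \<open>f\<close> and to its inverse, give an isomorphism.\<close>

lemma end_isomorphism_move:
  assumes x: "non_root i p x" and x': "non_root i p' x'"
    and f: "colored_end_isomorphism (G i) (r i) (\<chi> i) f x x'"
  shows "colored_end_isomorphism product [] Map.empty (move f p p') (x # p) (x' # p')"
proof -
  note xD = non_rootD[OF x] and x'D = non_rootD[OF x']
  note closed = piece_closed[OF xD(2)]
  define g where "g = inv_into (cone i x) f"
  have g: "colored_end_isomorphism (G i) (r i) (\<chi> i) g x' x"
    unfolding g_def by (rule colored_end_isomorphism_inverse[OF closed xD(3) f])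
  have bij: "bij_betw f (cone i x) (cone i x')"
    using f by (simp add: colored_end_isomorphism_iff lgraph_iso_def)
  have gf: "g (f y) = y" if "y \<in> cone i x" for y
    unfolding g_def by (rule bij_betw_inv_into_left[OF bij that])
  have fg: "f (g y) = y" if "y \<in> cone i x'" for y
    unfolding g_def by (rule bij_betw_inv_into_right[OF bij that])
  note cone = verts_end_cone_product[OF x] and cone' = verts_end_cone_product[OF x']
  have edges: "(u, a, w) \<in> edges (end_cone product [] (x # p)) \<longleftrightarrow>
      (u, a, w) \<in> edges product \<and> u \<in> hanging i p x \<and> w \<in> hanging i p x" for u a w
    unfolding edges_end_cone[OF closed_edges_product xD(5)] cone by simp
  have edges': "(u, a, w) \<in> edges (end_cone product [] (x' # p')) \<longleftrightarrow>
      (u, a, w) \<in> edges product \<and> u \<in> hanging i p' x' \<and> w \<in> hanging i p' x'" for u a w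
    unfolding edges_end_cone[OF closed_edges_product x'D(5)] cone' by simp
  have "lgraph_iso (move f p p') (end_cone product [] (x # p)) (end_cone product [] (x' # p'))"
  proof (rule lgraph_isoI[where g = "move g p' p"])
    show "closed_edges (end_cone product [] (x' # p'))"
      by (rule closed_edges_end_cone[OF closed_edges_product x'D(5)])
  next
    fix u assume "u \<in> verts (end_cone product [] (x # p))"
    then have u: "u \<in> hanging i p x" unfolding cone .
    moreover from u have "move g p' p (move f p p' u) = u" using gf by (auto simp: hanging_def)
    ultimately show "move f p p' u \<in> verts (end_cone product [] (x' # p'))
        \<and> move g p' p (move f p p' u) = u"
      unfolding cone' using move_in_hanging[OF x x' f] by blast
  next
    fix u assume "u \<in> verts (end_cone product [] (x' # p'))"
    then have u: "u \<in> hanging i p' x'" unfolding cone' .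
    moreover from u have "move f p p' (move g p' p u) = u" using fg by (auto simp: hanging_def)
    ultimately show "move g p' p u \<in> verts (end_cone product [] (x # p))
        \<and> move f p p' (move g p' p u) = u"
      unfolding cone using move_in_hanging[OF x' x g] by blast
  next
    fix u a w assume "(u, a, w) \<in> edges (end_cone product [] (x # p))"
    then show "(move f p p' u, a, move f p p' w) \<in> edges (end_cone product [] (x' # p'))"
      unfolding edges edges' using move_edge[OF x x' f] move_in_hanging[OF x x' f] by blast
  next
    fix u a w assume "(u, a, w) \<in> edges (end_cone product [] (x' # p'))"
    then show "(move g p' p u, a, move g p' p w) \<in> edges (end_cone product [] (x # p))"
      unfolding edges edges' using move_edge[OF x' x g] move_in_hanging[OF x' x g] by blast
  qed
  moreover have "move f p p' ` frontier product [] (x # p) = frontier product [] (x' # p')"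
  proof -
    have "f ` frontier (G i) (r i) x = frontier (G i) (r i) x'"
      using f by (simp add: colored_end_isomorphism_iff)
    then show ?thesis
      unfolding frontier_product[OF x] frontier_product[OF x'] by (auto simp: image_image)
  qed
  ultimately show ?thesis by (simp add: colored_end_isomorphism_iff)
qed

lemma context_free_product:
  assumes "finite I" and cf: "\<And>i. i \<in> I \<Longrightarrow> colored_context_free (G i) (r i) (\<chi> i)"
  shows "context_free product []"
  unfolding context_free_eq_colored colored_context_free_iff
proof (rule finite_quotientI)
  let ?Q = "\<lambda>i. verts (G i) // colored_cone_equiv (G i) (r i) (\<chi> i)"
  (* The cover: the root by itself, and for each piece and each class of its vertices
     all occurrences of vertices of this class in copies of the piece. *)
  let ?P = "\<lambda>i X. {x # p | x p. non_root i p x \<and> x \<in> X}"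
  have equiv: "equiv (verts (G i)) (colored_cone_equiv (G i) (r i) (\<chi> i))" if "i \<in> I" for i
    using that by (intro equiv_colored_cone_equiv piece_closed)
  show equiv_product: "equiv (verts product) (colored_cone_equiv product [] (Map.empty :: _ \<rightharpoonup> unit))"
    by (intro equiv_colored_cone_equiv closed_edges_product)
  show "finite (insert {[]} (\<Union>i\<in>I. ?P i ` ?Q i))"
    using assms by (simp add: colored_context_free_iff)
  show "verts product \<subseteq> \<Union> (insert {[]} (\<Union>i\<in>I. ?P i ` ?Q i))"
  proof
    fix v assume v: "v \<in> verts product"
    show "v \<in> \<Union> (insert {[]} (\<Union>i\<in>I. ?P i ` ?Q i))"
    proof (cases v)
      case (Cons x p)
      with v obtain i where i: "non_root i p x" by (auto simp: Cons_in_verts_iff non_root_def)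
      note iD = non_rootD[OF i]
      obtain X where "X \<in> ?Q i" "x \<in> X"
        using iD(3) Union_quotient[OF equiv[OF iD(2)]] by blast
      with i iD(2) Cons show ?thesis by auto
    qed simp
  qed
  fix P u v assume P: "P \<in> insert {[]} (\<Union>i\<in>I. ?P i ` ?Q i)" and uv: "u \<in> P" "v \<in> P"
  show "(u, v) \<in> colored_cone_equiv product [] (Map.empty :: _ \<rightharpoonup> unit)"
  proof (cases "P = {[]}")
    case True
    then show ?thesis
      using uv equiv_class_self[OF equiv_product Nil_in_verts] by simp
  next
    case False
    with P uv obtain i X x p x' p' where X: "i \<in> I" "X \<in> ?Q i" "x \<in> X" "x' \<in> X"
      and x: "u = x # p" "non_root i p x" and x': "v = x' # p'" "non_root i p' x'" by blast
    have "(x, x') \<in> colored_cone_equiv (G i) (r i) (\<chi> i)"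
      using X(3,4) by (intro in_quotient_imp_in_rel[OF equiv[OF X(1)] X(2)]) simp
    then obtain f where f: "colored_end_isomorphism (G i) (r i) (\<chi> i) f x x'"
      unfolding colored_cone_equiv_def by blast
    show ?thesis
      unfolding x(1) x'(1)
      by (rule colored_cone_equivI[OF _ _ end_isomorphism_move[OF x(2) x'(2) f]])
        (rule non_rootD(5)[OF x(2)] non_rootD(5)[OF x'(2)])+
  qed
qed

end

section \<open>The free product as a product of alternating pieces\<close>

definition pieces ::
    "(nat \<Rightarrow> ('v, 'a) lgraph) \<Rightarrow> (nat \<Rightarrow> ('w, 'a) lgraph) \<Rightarrow> nat + nat \<Rightarrow> ('v + 'w, 'a) lgraph" where
  "pieces \<Gamma> \<Lambda> = case_sum (\<lambda>s. rename Inl (\<Gamma> s)) (\<lambda>s. rename Inr (\<Lambda> s))"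

definition colors :: "(nat \<Rightarrow> 'v \<rightharpoonup> nat) \<Rightarrow> (nat \<Rightarrow> 'w \<rightharpoonup> nat) \<Rightarrow> nat + nat \<Rightarrow> 'v + 'w \<rightharpoonup> nat + nat" where
  "colors \<psi>\<^sub>1 \<psi>\<^sub>2 = case_sum
    (\<lambda>s. case_sum (\<lambda>\<gamma>. map_option Inr (\<psi>\<^sub>1 s \<gamma>)) (\<lambda>_. None))
    (\<lambda>s. case_sum (\<lambda>_. None) (\<lambda>l. map_option Inl (\<psi>\<^sub>2 s l)))"

theorem theorem9p5:
  fixes \<iota> :: "'a \<Rightarrow> 'a" and A\<^sub>1 A\<^sub>2 :: "'a set" and k m :: nat
    and \<Gamma> :: "nat \<Rightarrow> ('v, 'a) lgraph" and \<gamma>\<^sub>0 :: "nat \<Rightarrow> 'v"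
    and \<Lambda> :: "nat \<Rightarrow> ('w, 'a) lgraph" and l\<^sub>0 :: "nat \<Rightarrow> 'w"
    and \<psi>\<^sub>1 :: "nat \<Rightarrow> 'v \<rightharpoonup> nat" and \<psi>\<^sub>2 :: "nat \<Rightarrow> 'w \<rightharpoonup> nat"
  assumes "alphabet \<iota> A\<^sub>1" and "alphabet \<iota> A\<^sub>2" and "A\<^sub>1 \<inter> A\<^sub>2 = {}"
    and "1 \<le> k" and "1 \<le> m"
    and "\<forall>i\<in>{1..k}. rooted_A_graph \<iota> A\<^sub>1 (\<Gamma> i) (\<gamma>\<^sub>0 i)"
    and "\<forall>j\<in>{1..m}. rooted_A_graph \<iota> A\<^sub>2 (\<Lambda> j) (l\<^sub>0 j)"
    and "gluing_map k \<Gamma> \<gamma>\<^sub>0 m \<Lambda> l\<^sub>0 \<psi>\<^sub>1 \<psi>\<^sub>2"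
    and "context_free_ensemble k \<Gamma> \<gamma>\<^sub>0 m \<Lambda> l\<^sub>0 \<psi>\<^sub>1 \<psi>\<^sub>2"
  shows "rooted_A_graph \<iota> (A\<^sub>1 \<union> A\<^sub>2) (free_product \<Gamma> \<gamma>\<^sub>0 \<Lambda> l\<^sub>0 \<psi>\<^sub>1 \<psi>\<^sub>2) free_product_root \<and>
    context_free (free_product \<Gamma> \<gamma>\<^sub>0 \<Lambda> l\<^sub>0 \<psi>\<^sub>1 \<psi>\<^sub>2) free_product_root"
proof -
  let ?G = "pieces \<Gamma> \<Lambda>" and ?r = "case_sum (\<lambda>s. Inl (\<gamma>\<^sub>0 s)) (\<lambda>s. Inr (l\<^sub>0 s)) :: nat + nat \<Rightarrow> 'v + 'w"
  let ?\<chi> = "colors \<psi>\<^sub>1 \<psi>\<^sub>2" and ?I = "{1..k} <+> {1..m}"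
  let ?alph = "\<lambda>b. if b then A\<^sub>1 else A\<^sub>2"
  interpret alternating_gluing \<iota> ?alph ?I isl "\<lambda>b. if b then Inl 1 else Inr 1" ?G ?r isl ?\<chi>
  proof
    show "alphabet \<iota> (?alph b)" for b using assms(1,2) by simp
    show "?alph True \<inter> ?alph False = {}" using assms(3) by simp
    show "(if b then Inl 1 else Inr 1) \<in> ?I" "isl (if b then Inl 1 else Inr 1 :: nat + nat) = b" for b
      using assms(4,5) by auto
    fix i assume i: "i \<in> ?I"
    show "rooted_A_graph \<iota> (?alph (isl i)) (?G i) (?r i)"
    proof (cases i)
      case (Inl s)
      with i have "rooted_A_graph \<iota> A\<^sub>1 (\<Gamma> s) (\<gamma>\<^sub>0 s)" using assms(6) by auto
      from rooted_A_graph_rename[OF inj_Inl this] show ?thesis by (simp add: pieces_def Inl)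
    next
      case (Inr s)
      with i have "rooted_A_graph \<iota> A\<^sub>2 (\<Lambda> s) (l\<^sub>0 s)" using assms(7) by auto
      from rooted_A_graph_rename[OF inj_Inr this] show ?thesis by (simp add: pieces_def Inr)
    qed
    show "isl x = isl i" if "x \<in> verts (?G i)" for x
      using i that by (auto simp: pieces_def)
    show "coloring (?G i) (?r i) {j \<in> ?I. isl j \<noteq> isl i} (?\<chi> i)"
    proof (cases i)
      case (Inl s)
      have "coloring (rename Inl (\<Gamma> s)) (Inl (\<gamma>\<^sub>0 s)) {j \<in> ?I. isl j \<noteq> isl i} (?\<chi> i)"
      proof (rule coloring_rename[where c = Inr])
        show "coloring (\<Gamma> s) (\<gamma>\<^sub>0 s) {1..m} (\<psi>\<^sub>1 s)"
          using assms(8) i Inl by (auto simp: gluing_map_def)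
        show "?\<chi> i z = None" if "z \<notin> range Inl" for z
          using that by (cases z) (auto simp: colors_def Inl)
      qed (auto simp: colors_def Inl)
      then show ?thesis by (simp add: pieces_def Inl)
    next
      case (Inr s)
      have "coloring (rename Inr (\<Lambda> s)) (Inr (l\<^sub>0 s)) {j \<in> ?I. isl j \<noteq> isl i} (?\<chi> i)"
      proof (rule coloring_rename[where c = Inl])
        show "coloring (\<Lambda> s) (l\<^sub>0 s) {1..k} (\<psi>\<^sub>2 s)"
          using assms(8) i Inr by (auto simp: gluing_map_def)
        show "?\<chi> i z = None" if "z \<notin> range Inr" for z
          using that by (cases z) (auto simp: colors_def Inr)
      qed (auto simp: colors_def Inr)
      then show ?thesis by (simp add: pieces_def Inr)
    qed
  qed
  let ?copy\<^sub>1 = "copy\<^sub>1 \<Gamma> \<gamma>\<^sub>0 \<Lambda> l\<^sub>0 \<psi>\<^sub>1 \<psi>\<^sub>2" and ?copy\<^sub>2 = "copy\<^sub>2 \<Gamma> \<gamma>\<^sub>0 \<Lambda> l\<^sub>0 \<psi>\<^sub>1 \<psi>\<^sub>2"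
  (* The copies of the free product are those of the locale, because the latter's
     gluing rule splits into the two mutual rules according to the side. *)
  have "case_sum ?copy\<^sub>1 ?copy\<^sub>2 i p" if "copy i p" for i p
    using that
  proof (induction rule: copy.induct)
    case (init b)
    show ?case
      using init\<^sub>1[of \<Gamma> \<gamma>\<^sub>0 \<Lambda> l\<^sub>0 \<psi>\<^sub>1 \<psi>\<^sub>2] init\<^sub>2[of \<Gamma> \<gamma>\<^sub>0 \<Lambda> l\<^sub>0 \<psi>\<^sub>1 \<psi>\<^sub>2] by simp
  next
    case (glue i p x j)
    show ?case
    proof (cases i)
      case (Inl s)
      with glue show ?thesis by (auto simp: pieces_def colors_def intro!: glue\<^sub>2[where j = s])
    next
      case (Inr s)
      with glue show ?thesis by (auto simp: pieces_def colors_def intro!: glue\<^sub>1[where j = s])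
    qed
  qed
  moreover have "?copy\<^sub>1 s p \<Longrightarrow> copy (Inl s) p" and "?copy\<^sub>2 s p \<Longrightarrow> copy (Inr s) p" for s p
  proof (induction rule: copy\<^sub>1_copy\<^sub>2.inducts)
    case init\<^sub>1
    show ?case using init[of True] by simp
  next
    case init\<^sub>2
    show ?case using init[of False] by simp
  next
    case (glue\<^sub>2 j p \<gamma> s)
    then show ?case by (intro glue[of "Inl j"]) (auto simp: pieces_def colors_def)
  next
    case (glue\<^sub>1 j p l s)
    then show ?case by (intro glue[of "Inr j"]) (auto simp: pieces_def colors_def)
  qed
  ultimately have copy_iff: "copy (Inl s) p \<longleftrightarrow> ?copy\<^sub>1 s p" "copy (Inr s) p \<longleftrightarrow> ?copy\<^sub>2 s p" for s p
    by (metis sum.case)+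
  have spot: "spot (Inl s) p (Inl x) = place Inl (\<gamma>\<^sub>0 s) p x"
    "spot (Inr s) p (Inr y) = place Inr (l\<^sub>0 s) p y" for s p x y
    by (simp_all add: spot_def place_def)
  have product_eq: "free_product \<Gamma> \<gamma>\<^sub>0 \<Lambda> l\<^sub>0 \<psi>\<^sub>1 \<psi>\<^sub>2 = product"
  proof (intro lgraph.equality)
    have split: "(\<exists>i p. copy i p \<and> Q i p) \<longleftrightarrow>
        (\<exists>s p. ?copy\<^sub>1 s p \<and> Q (Inl s) p) \<or> (\<exists>s p. ?copy\<^sub>2 s p \<and> Q (Inr s) p)" for Q
      unfolding split_sum_ex copy_iff ..
    have "u \<in> verts product \<longleftrightarrow> (\<exists>i p. copy i p \<and> (\<exists>x\<in>verts (?G i). u = spot i p x))" for u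
      unfolding product_def by auto
    then have product_verts: "u \<in> verts product \<longleftrightarrow>
        (\<exists>s p. ?copy\<^sub>1 s p \<and> (\<exists>x\<in>verts (\<Gamma> s). u = place Inl (\<gamma>\<^sub>0 s) p x)) \<or>
        (\<exists>s p. ?copy\<^sub>2 s p \<and> (\<exists>x\<in>verts (\<Lambda> s). u = place Inr (l\<^sub>0 s) p x))" for u
      unfolding split by (simp add: pieces_def spot)
    show "verts (free_product \<Gamma> \<gamma>\<^sub>0 \<Lambda> l\<^sub>0 \<psi>\<^sub>1 \<psi>\<^sub>2) = verts product"
      unfolding set_eq_iff product_verts
      unfolding free_product_def lgraph.select_convs Un_iff mem_Collect_eq by blast
    have all_edges: "(u, a, w) \<in> edges product \<longleftrightarrow>
        (\<exists>i p. copy i p \<and> (\<exists>x y. (x, a, y) \<in> edges (?G i) \<and> u = spot i p x \<and> w = spot i p y))" for u a w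
      unfolding edges_product_iff by blast
    have product_edges: "(u, a, w) \<in> edges product \<longleftrightarrow>
        (\<exists>s p. ?copy\<^sub>1 s p \<and> (\<exists>x y. (x, a, y) \<in> edges (\<Gamma> s) \<and>
          u = place Inl (\<gamma>\<^sub>0 s) p x \<and> w = place Inl (\<gamma>\<^sub>0 s) p y)) \<or>
        (\<exists>s p. ?copy\<^sub>2 s p \<and> (\<exists>x y. (x, a, y) \<in> edges (\<Lambda> s) \<and>
          u = place Inr (l\<^sub>0 s) p x \<and> w = place Inr (l\<^sub>0 s) p y))" for u a w
    proof -
      have "(\<exists>x y. (x, a, y) \<in> edges (?G (Inl s)) \<and> u = spot (Inl s) p x \<and> w = spot (Inl s) p y) \<longleftrightarrow>
          (\<exists>x y. (x, a, y) \<in> edges (\<Gamma> s) \<and> u = place Inl (\<gamma>\<^sub>0 s) p x \<and> w = place Inl (\<gamma>\<^sub>0 s) p y)" for s p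
        unfolding spot(1)[symmetric] by (auto simp: pieces_def edges_rename_iff)
      moreover have "(\<exists>x y. (x, a, y) \<in> edges (?G (Inr s)) \<and> u = spot (Inr s) p x \<and> w = spot (Inr s) p y) \<longleftrightarrow>
          (\<exists>x y. (x, a, y) \<in> edges (\<Lambda> s) \<and> u = place Inr (l\<^sub>0 s) p x \<and> w = place Inr (l\<^sub>0 s) p y)" for s p
        unfolding spot(2)[symmetric] by (auto simp: pieces_def edges_rename_iff)
      ultimately show ?thesis
        unfolding all_edges split by simp
    qed
    have "(u, a, w) \<in> edges (free_product \<Gamma> \<gamma>\<^sub>0 \<Lambda> l\<^sub>0 \<psi>\<^sub>1 \<psi>\<^sub>2) \<longleftrightarrow> (u, a, w) \<in> edges product" for u a w
      unfolding product_edges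
      unfolding free_product_def lgraph.select_convs Un_iff mem_Collect_eq prod.inject by blast
    then show "edges (free_product \<Gamma> \<gamma>\<^sub>0 \<Lambda> l\<^sub>0 \<psi>\<^sub>1 \<psi>\<^sub>2) = edges product" by auto
  qed simp
  have "colored_context_free (?G i) (?r i) (?\<chi> i)" if i: "i \<in> ?I" for i
  proof (cases i)
    case (Inl s)
    with i have s: "s \<in> {1..k}" by auto
    have "colored_context_free (rename Inl (\<Gamma> s)) (Inl (\<gamma>\<^sub>0 s)) (?\<chi> i)"
      by (rule colored_context_free_rename[where c = Inr and \<chi> = "\<psi>\<^sub>1 s", OF _ _ bspec[OF assms(6) s]])
        (use assms(9) s in \<open>auto simp: colors_def Inl context_free_ensemble_def\<close>)
    then show ?thesis by (simp add: pieces_def Inl)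
  next
    case (Inr s)
    with i have s: "s \<in> {1..m}" by auto
    have "colored_context_free (rename Inr (\<Lambda> s)) (Inr (l\<^sub>0 s)) (?\<chi> i)"
      by (rule colored_context_free_rename[where c = Inl and \<chi> = "\<psi>\<^sub>2 s", OF _ _ bspec[OF assms(7) s]])
        (use assms(9) s in \<open>auto simp: colors_def Inr context_free_ensemble_def\<close>)
    then show ?thesis by (simp add: pieces_def Inr)
  qed
  then have "context_free product []" by (intro context_free_product) auto
  with rooted_A_graph_product show ?thesis
    by (simp add: product_eq free_product_root_def)
qed

end
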